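(* Let $M$ be a matroid of rank $r$ on the ground set $E$, and let $B_M(\mathbf{x})$ be its basis generating polynomial. (a) If $M$ is a regular [= real-unimodular] matroid, then $B_M^{-\beta}$ is completely monotone on $(0,\infty)^E$ for $\beta=0,\frac12,1,\frac32,\ldots$ and for all real $\beta\ge(r-1)/2$. (This holds in particular if $M$ is a graphic or cographic matroid, i.e. for the spanning-tree or complementary-spanning-tree polynomial of a connected graph.) (b) If $M$ is a complex-unimodular matroid [= sixth-root-of-unity matroid], then $B_M^{-\beta}$ is completely monotone on $(0,\infty)^E$ for $\beta=0,1,2,3,\ldots$ and for all real $\beta\ge r-1$.
   Context: Matroids are finite. $B_M(\mathbf{x})=\sum_{S\in\mathcal{B}(M)}\prod_{e\in S}x_e$, where $\mathcal{B}(M)$ is the set of bases of $M$ and $\mathbf{x}=\{x_e\}_{e\in E}$. A matroid of rank $r$ is real-unimodular (resp. complex-unimodular) if it is represented by a real (resp. complex) matrix $B$ with exactly $r$ rows and with columns indexed by $E$, such that $|\det B_{\star S}|^2\in\{0,1\}$ for every $S\subseteq E$ with $|S|=r$, where $B_{\star S}$ is the submatrix of $B$ with columns $S$. A $C^\infty$ function $f$ on $(0,\infty)^E$ is completely monotone if $(-1)^k\,\partial^kf/\partial x_{e_1}\cdots\partial x_{e_k}\ge 0$ everywhere on $(0,\infty)^E$ for all $k\ge 0$ and all $e_1,\ldots,e_k\in E$. For a connected graph $G$ with edge set $E$, the complementary-spanning-tree polynomial is $\sum_T\prod_{e\in E\setminus T}x_e$, the sum running over edge sets $T$ of spanning trees.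 *)

theory Defs
  imports "HOL-Analysis.Analysis" "Jordan_Normal_Form.VS_Connect" "Jordan_Normal_Form.Determinant"
begin

locale matroid =
  fixes E :: "'e set" and indep :: "'e set \<Rightarrow> bool"
  assumes finite_ground: "finite E"
    and indep_subset_ground: "indep X \<Longrightarrow> X \<subseteq> E"
    and indep_empty: "indep {}"
    and indep_subset: "indep X \<Longrightarrow> Y \<subseteq> X \<Longrightarrow> indep Y"
    and indep_augment:
      "indep X \<Longrightarrow> indep Y \<Longrightarrow> card X < card Y \<Longrightarrow> \<exists>e\<in>Y - X. indep (insert e X)"

definition bases :: "'e set \<Rightarrow> ('e set \<Rightarrow> bool) \<Rightarrow> 'e set set" where
  "bases E indep = {B. B \<subseteq> E \<and> indep B \<and> (\<forall>X\<subseteq>E. indep X \<longrightarrow> B \<subseteq> X \<longrightarrow> X = B)}"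

definition matroid_rank :: "'e set \<Rightarrow> ('e set \<Rightarrow> bool) \<Rightarrow> nat" where
  "matroid_rank E indep = Max (card ` {X. X \<subseteq> E \<and> indep X})"

definition dual_indep :: "'e set \<Rightarrow> ('e set \<Rightarrow> bool) \<Rightarrow> 'e set \<Rightarrow> bool" where
  "dual_indep E indep X \<longleftrightarrow> (\<exists>B\<in>bases E indep. X \<subseteq> E - B)"

definition basis_poly :: "'e set \<Rightarrow> ('e set \<Rightarrow> bool) \<Rightarrow> ('e \<Rightarrow> real) \<Rightarrow> real" where
  "basis_poly E indep x = (\<Sum>S\<in>bases E indep. \<Prod>e\<in>S. x e)"

text \<open>A matrix with \<open>r\<close> rows and columns indexed by \<open>E\<close> is the family \<open>B\<close> of its columns,
  \<open>B e\<close> being a vector of dimension \<open>r\<close> for \<open>e \<in> E\<close>. Linear independence is that of the family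
  of columns: equal columns at distinct indices are dependent, hence the injectivity.\<close>

definition represents ::
    "nat \<Rightarrow> ('e \<Rightarrow> 'k::field vec) \<Rightarrow> 'e set \<Rightarrow> ('e set \<Rightarrow> bool) \<Rightarrow> bool" where
  "represents r B E indep \<longleftrightarrow>
     B ` E \<subseteq> carrier_vec r \<and>
     (\<forall>S\<subseteq>E. indep S \<longleftrightarrow>
        inj_on B S \<and> \<not> module.lin_dep (class_ring :: 'k ring) (module_vec TYPE('k) r) (B ` S))"

text \<open>An \<open>r\<close>-element subset \<open>S\<close> of \<open>E\<close> is given by an enumeration \<open>es\<close>; another enumeration
  changes the determinant of the submatrix with columns \<open>S\<close> by a sign only.\<close>

definition unimodular :: "nat \<Rightarrow> ('e \<Rightarrow> 'k::real_normed_field vec) \<Rightarrow> 'e set \<Rightarrow> bool" where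
  "unimodular r B E \<longleftrightarrow>
     (\<forall>es. distinct es \<and> set es \<subseteq> E \<and> length es = r \<longrightarrow>
        (norm (Determinant.det (mat_of_cols r (map B es))))\<^sup>2 \<in> {0, 1})"

definition real_unimodular :: "'e set \<Rightarrow> ('e set \<Rightarrow> bool) \<Rightarrow> bool" where
  "real_unimodular E indep \<longleftrightarrow>
     (\<exists>B :: 'e \<Rightarrow> real vec.
        represents (matroid_rank E indep) B E indep \<and> unimodular (matroid_rank E indep) B E)"

definition complex_unimodular :: "'e set \<Rightarrow> ('e set \<Rightarrow> bool) \<Rightarrow> bool" where
  "complex_unimodular E indep \<longleftrightarrow>
     (\<exists>B :: 'e \<Rightarrow> complex vec.
        represents (matroid_rank E indep) B E indep \<and> unimodular (matroid_rank E indep) B E)"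

text \<open>\<open>(0,\<infinity>)\<^sup>E\<close> is the set of extensional functions on \<open>E\<close> with positive values; its topology,
  as a subspace of the function type, is the product topology.\<close>

abbreviation pos_orthant :: "'e set \<Rightarrow> ('e \<Rightarrow> real) set" where
  "pos_orthant E \<equiv> E \<rightarrow>\<^sub>E {0<..}"

definition partial_deriv :: "'e \<Rightarrow> (('e \<Rightarrow> real) \<Rightarrow> real) \<Rightarrow> ('e \<Rightarrow> real) \<Rightarrow> real" where
  "partial_deriv e f x = deriv (\<lambda>t. f (x(e := t))) (x e)"

definition partial_derivs :: "'e list \<Rightarrow> (('e \<Rightarrow> real) \<Rightarrow> real) \<Rightarrow> ('e \<Rightarrow> real) \<Rightarrow> real" where
  "partial_derivs es f = foldr partial_deriv es f"

text \<open>All iterated partial derivatives exist and are continuous. Existence has to be required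
  separately, as \<^const>\<open>deriv\<close> is total.\<close>

definition smooth_on_orthant :: "'e set \<Rightarrow> (('e \<Rightarrow> real) \<Rightarrow> real) \<Rightarrow> bool" where
  "smooth_on_orthant E f \<longleftrightarrow>
     (\<forall>es\<in>lists E.
        continuous_on (pos_orthant E) (partial_derivs es f) \<and>
        (\<forall>x\<in>pos_orthant E. \<forall>e\<in>E.
           (\<lambda>t. partial_derivs es f (x(e := t))) field_differentiable (at (x e))))"

definition completely_monotone :: "'e set \<Rightarrow> (('e \<Rightarrow> real) \<Rightarrow> real) \<Rightarrow> bool" where
  "completely_monotone E f \<longleftrightarrow>
     smooth_on_orthant E f \<and>
     (\<forall>es\<in>lists E. \<forall>x\<in>pos_orthant E. (-1) ^ length es * partial_derivs es f x \<ge> 0)"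

text \<open>Finite undirected graphs, with loops and multiple edges allowed; \<open>ends e\<close> is the set of
  endpoints of the edge \<open>e\<close>, a singleton for a loop.\<close>

locale multigraph =
  fixes V :: "'v set" and E :: "'e set" and ends :: "'e \<Rightarrow> 'v set"
  assumes finite_verts: "finite V"
    and finite_edges: "finite E"
    and ends_in_verts: "e \<in> E \<Longrightarrow> ends e \<subseteq> V"
    and card_ends: "e \<in> E \<Longrightarrow> card (ends e) = 1 \<or> card (ends e) = 2"

definition adjacent_via :: "('e \<Rightarrow> 'v set) \<Rightarrow> 'e set \<Rightarrow> ('v \<times> 'v) set" where
  "adjacent_via ends F = {(u, v). \<exists>e\<in>F. ends e = {u, v}}"

definition connected_by :: "'v set \<Rightarrow> ('e \<Rightarrow> 'v set) \<Rightarrow> 'e set \<Rightarrow> bool" where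
  "connected_by V ends F \<longleftrightarrow>
     V \<noteq> {} \<and> (\<forall>u\<in>V. \<forall>v\<in>V. (u, v) \<in> (adjacent_via ends F)\<^sup>*)"

text \<open>A cycle is given by its successive vertices and edges; a loop is a cycle of length 1, and two
  parallel edges form a cycle of length 2.\<close>

definition is_cycle :: "('e \<Rightarrow> 'v set) \<Rightarrow> 'v list \<Rightarrow> 'e list \<Rightarrow> bool" where
  "is_cycle ends vs es \<longleftrightarrow>
     es \<noteq> [] \<and> length vs = length es \<and> distinct vs \<and> distinct es \<and>
     (\<forall>i<length es. ends (es ! i) = {vs ! i, vs ! (Suc i mod length es)})"

definition graphic_indep :: "'e set \<Rightarrow> ('e \<Rightarrow> 'v set) \<Rightarrow> 'e set \<Rightarrow> bool" where
  "graphic_indep E ends F \<longleftrightarrow> F \<subseteq> E \<and> \<not> (\<exists>vs es. is_cycle ends vs es \<and> set es \<subseteq> F)"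

abbreviation cographic_indep :: "'e set \<Rightarrow> ('e \<Rightarrow> 'v set) \<Rightarrow> 'e set \<Rightarrow> bool" where
  "cographic_indep E ends \<equiv> dual_indep E (graphic_indep E ends)"

definition spanning_trees :: "'v set \<Rightarrow> 'e set \<Rightarrow> ('e \<Rightarrow> 'v set) \<Rightarrow> 'e set set" where
  "spanning_trees V E ends =
     {T. T \<subseteq> E \<and> connected_by V ends T \<and> \<not> (\<exists>vs es. is_cycle ends vs es \<and> set es \<subseteq> T)}"

definition spanning_tree_poly ::
    "'v set \<Rightarrow> 'e set \<Rightarrow> ('e \<Rightarrow> 'v set) \<Rightarrow> ('e \<Rightarrow> real) \<Rightarrow> real" where
  "spanning_tree_poly V E ends x = (\<Sum>T\<in>spanning_trees V E ends. \<Prod>e\<in>T. x e)"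

definition complementary_spanning_tree_poly ::
    "'v set \<Rightarrow> 'e set \<Rightarrow> ('e \<Rightarrow> 'v set) \<Rightarrow> ('e \<Rightarrow> real) \<Rightarrow> real" where
  "complementary_spanning_tree_poly V E ends x =
     (\<Sum>T\<in>spanning_trees V E ends. \<Prod>e\<in>E - T. x e)"

definition real_exponents :: "nat \<Rightarrow> real set" where
  "real_exponents r = {\<beta>. (\<exists>n::nat. \<beta> = real n / 2) \<or> \<beta> \<ge> (real r - 1) / 2}"

definition complex_exponents :: "nat \<Rightarrow> real set" where
  "complex_exponents r = {\<beta>. (\<exists>n::nat. \<beta> = real n) \<or> \<beta> \<ge> real r - 1}"

end

theory Submission
  imports Defs "HOL-Probability.Distributions" "Jordan_Normal_Form.DL_Rank"
begin

text \<open>Writing \<open>X = \<Sum>\<^sub>e x\<^sub>e v\<^sub>e\<^sup>* v\<^sub>e\<close>, the Cauchy-Binet formula turns the basis polynomial of a unimodular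
  matroid into \<open>det X\<close>. Factor \<open>X = U\<^sup>* diag(p) U\<close> with \<open>U\<close> unitriangular, so that
  \<open>det X = \<Prod>\<^sub>k p\<^sub>k\<close>, and put \<open>\<delta> = 1/2\<close> over the reals and \<open>\<delta> = 1\<close> over the complex numbers. Then
  \<open>p\<^sub>k\<^bsup>-\<gamma>\<^esup> \<Prod>\<^sub>j\<^sub>>\<^sub>k p\<^sub>j\<^bsup>-\<delta>\<^esup>\<close> is completely monotone for every \<open>\<gamma> \<ge> 0\<close>: up to a Gamma integral over
  \<open>s = |y\<^sub>k|\<^sup>2\<close>, it is the Gaussian integral over \<open>y\<^sub>j\<close>, \<open>j > k\<close>, of
  \<open>exp (- \<Sum>\<^sub>e x\<^sub>e |\<langle>v\<^sub>e, y\<rangle>|\<^sup>2)\<close>. Multiplying these functions with \<open>\<gamma> = \<beta> - k \<delta>\<close>, \<open>0 \<le> k < r\<close>, gives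
  \<open>(det X)\<^bsup>-\<beta>\<^esup>\<close>, which explains the condition \<open>\<beta> \<ge> (r - 1) \<delta>\<close>; the powers of the function with \<open>k = 0\<close>,
  \<open>\<gamma> = \<delta>\<close> give the multiples of \<open>\<delta>\<close>. Graphic and cographic matroids are represented by integral
  coordinates with respect to a spanning forest: the coordinate matrix of any other spanning forest has
  an integral inverse, so its determinant is \<open>\<plusminus>1\<close>.\<close>

section \<open>Alternating finite differences\<close>

text \<open>The factors are known only as integrals with x as a parameter, and \<open>p\<close>,
  \<open>U\<close> are obtained at each x separately, so their derivatives are hard to reach. The
  signs of iterated forward differences can be followed instead: they survive sums, products,
  integrals and pointwise limits. Smoothness enters only for the final power of the basis
  polynomial, where it is evident, and there the signs of differences become signs of derivatives.
  The constant \<delta> is half the real dimension of the field: a Gaussian integral over one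
  variable with weight s is s to the power -\<delta>, whatever its centre, and this independence of
  the centre is what removes the entries of \<open>U\<close>. The variables before k are set to
  zero, which makes the rows before k disappear; therefore factor k involves only the p_j with j
  \<ge> k. For the dual of a graphic matroid, substituting 1/x_e for x_e and applying Sylvester's
  determinant identity produces another Gram determinant, and a Gram determinant is all that the
  analytic part asks for.\<close>

definition fdiff :: "'e \<Rightarrow> real \<Rightarrow> (('e \<Rightarrow> real) \<Rightarrow> real) \<Rightarrow> ('e \<Rightarrow> real) \<Rightarrow> real" where
  "fdiff e h f = (\<lambda>x. f x - f (x(e := x e + h)))"

text \<open>Forward steps never leave the orthant, so the notion speaks only about values there.
  Nonnegativity is repeated at every level so that level n + 1 implies level n.\<close>

primrec diff_monotone :: "nat \<Rightarrow> 'e set \<Rightarrow> (('e \<Rightarrow> real) \<Rightarrow> real) \<Rightarrow> bool" where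
  "diff_monotone 0 E f \<longleftrightarrow> (\<forall>x\<in>pos_orthant E. 0 \<le> f x)"
| "diff_monotone (Suc n) E f \<longleftrightarrow>
     (\<forall>x\<in>pos_orthant E. 0 \<le> f x) \<and> (\<forall>e\<in>E. \<forall>h>0. diff_monotone n E (fdiff e h f))"

lemma orthant_update: "x \<in> pos_orthant E \<Longrightarrow> e \<in> E \<Longrightarrow> t > 0 \<Longrightarrow> x(e := t) \<in> pos_orthant E"
  by (auto simp: PiE_iff extensional_def)

lemma orthant_shift:
  "x \<in> pos_orthant E \<Longrightarrow> e \<in> E \<Longrightarrow> h > 0 \<Longrightarrow> x(e := x e + h) \<in> pos_orthant E"
  by (rule orthant_update) (auto simp: PiE_iff intro: add_pos_pos)

lemma diff_monotone_nonneg: "diff_monotone n E f \<Longrightarrow> x \<in> pos_orthant E \<Longrightarrow> 0 \<le> f x"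
  by (cases n) auto

lemma diff_monotone_cong:
  assumes "\<And>x. x \<in> pos_orthant E \<Longrightarrow> f x = g x" "diff_monotone n E g"
  shows "diff_monotone n E f"
  using assms
proof (induction n arbitrary: f g)
  case (Suc n)
  have "diff_monotone n E (fdiff e h f)" if e: "e \<in> E" and h: "h > 0" for e h
  proof (rule Suc.IH)
    show "fdiff e h f x = fdiff e h g x" if "x \<in> pos_orthant E" for x
      using Suc.prems(1)[OF that] Suc.prems(1)[OF orthant_shift[OF that e h]] by (simp only: fdiff_def)
    show "diff_monotone n E (fdiff e h g)" using Suc.prems(2) e h by simp
  qed
  then show ?case using Suc.prems by auto
qed auto

lemma diff_monotone_Suc: "diff_monotone (Suc n) E f \<Longrightarrow> diff_monotone n E f"
  by (induction n arbitrary: f) auto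

text \<open>Differences commute with shifts along any coordinate. The shift is the one that occurs
  in the product rule below.\<close>

lemma diff_monotone_shift:
  assumes "e \<in> E" "h > 0" "diff_monotone n E f"
  shows "diff_monotone n E (\<lambda>x. f (x(e := x e + h)))"
  using assms(3)
proof (induction n arbitrary: f)
  case 0
  then show ?case
    unfolding diff_monotone.simps by (intro ballI) (erule bspec, erule orthant_shift[OF _ assms(1,2)])
next
  case (Suc n)
  have eq: "fdiff d k (\<lambda>x. f (x(e := x e + h))) = (\<lambda>x. fdiff d k f (x(e := x e + h)))" for d k
    by (cases "d = e") (auto simp: fdiff_def fun_upd_twist add_ac)
  have "diff_monotone n E (fdiff d k (\<lambda>x. f (x(e := x e + h))))" if "d \<in> E" "k > 0" for d k
    unfolding eq by (rule Suc.IH) (use Suc.prems that in simp)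
  then show ?case
    unfolding diff_monotone.simps
    by (intro conjI ballI diff_monotone_nonneg[OF Suc.prems] orthant_shift[OF _ assms(1,2)]) auto
qed

lemma diff_monotone_add:
  "diff_monotone n E f \<Longrightarrow> diff_monotone n E g \<Longrightarrow> diff_monotone n E (\<lambda>x. f x + g x)"
proof (induction n arbitrary: f g)
  case (Suc n)
  have "fdiff e h (\<lambda>x. f x + g x) = (\<lambda>x. fdiff e h f x + fdiff e h g x)" for e h
    by (auto simp: fdiff_def)
  then show ?case using Suc by auto
qed auto

text \<open>Discrete Leibniz rule: the difference of f g is (difference of f) times g plus (shifted
  f) times (difference of g), and all four functions are monotone to order n.\<close>

lemma diff_monotone_mult:
  "diff_monotone n E f \<Longrightarrow> diff_monotone n E g \<Longrightarrow> diff_monotone n E (\<lambda>x. f x * g x)"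
proof (induction n arbitrary: f g)
  case (Suc n)
  have "diff_monotone n E (fdiff e h (\<lambda>x. f x * g x))" if e: "e \<in> E" and h: "h > 0" for e h
  proof -
    have eq: "fdiff e h (\<lambda>x. f x * g x) =
        (\<lambda>x. fdiff e h f x * g x + f (x(e := x e + h)) * fdiff e h g x)"
      by (auto simp: fdiff_def algebra_simps)
    have shift: "diff_monotone n E (\<lambda>x. f (x(e := x e + h)))"
      by (rule diff_monotone_shift[OF e h diff_monotone_Suc[OF Suc.prems(1)]])
    have "diff_monotone n E (fdiff e h f)" "diff_monotone n E (fdiff e h g)"
      using Suc.prems e h by simp_all
    then show ?thesis
      unfolding eq
      by (intro diff_monotone_add Suc.IH[OF _ diff_monotone_Suc[OF Suc.prems(2)]] Suc.IH[OF shift])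
  qed
  then show ?case using Suc.prems by simp
qed auto

lemma diff_monotone_const: "c \<ge> 0 \<Longrightarrow> diff_monotone n E (\<lambda>x. c)"
proof (induction n arbitrary: c)
  case (Suc n)
  then show ?case using Suc.IH[of 0] by (auto simp: fdiff_def)
qed auto

lemma diff_monotone_prod:
  "finite K \<Longrightarrow> (\<And>k. k \<in> K \<Longrightarrow> diff_monotone n E (f k)) \<Longrightarrow> diff_monotone n E (\<lambda>x. \<Prod>k\<in>K. f k x)"
  by (induction K rule: finite_induct) (auto intro!: diff_monotone_const diff_monotone_mult)

lemma diff_monotone_power: "diff_monotone n E f \<Longrightarrow> diff_monotone n E (\<lambda>x. f x ^ m)"
  by (induction m) (auto intro!: diff_monotone_const diff_monotone_mult)

text \<open>A difference in direction e only multiplies the exponential by 1 - exp (- h c_e), which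
  is nonnegative; the induction therefore carries a nonnegative factor \<open>a\<close>.\<close>

lemma diff_monotone_exp:
  assumes "finite E" "\<And>e. e \<in> E \<Longrightarrow> c e \<ge> 0"
  shows "diff_monotone n E (\<lambda>x. exp (- (\<Sum>e\<in>E. x e * c e)))"
proof -
  have "diff_monotone n E (\<lambda>x. a * exp (- (\<Sum>e\<in>E. x e * c e)))" if "a \<ge> 0" for a :: real
    using that
  proof (induction n arbitrary: a)
    case (Suc n)
    have "diff_monotone n E (fdiff e h (\<lambda>x. a * exp (- (\<Sum>e\<in>E. x e * c e))))"
      if e: "e \<in> E" and h: "h > 0" for e h
    proof -
      have "(\<Sum>d\<in>E. (x(e := x e + h)) d * c d) = (\<Sum>d\<in>E. x d * c d) + h * c e" for x
        using e assms(1) by (simp add: sum.remove algebra_simps)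
      then have "fdiff e h (\<lambda>x. a * exp (- (\<Sum>e\<in>E. x e * c e))) =
          (\<lambda>x. (a * (1 - exp (- (h * c e)))) * exp (- (\<Sum>e\<in>E. x e * c e)))"
        unfolding fdiff_def by (intro ext) (simp add: exp_diff exp_minus field_simps)
      moreover have "0 \<le> a * (1 - exp (- (h * c e)))"
        using Suc.prems h assms(2)[OF e] by simp
      ultimately show ?thesis using Suc.IH by simp
    qed
    then show ?case using Suc.prems by auto
  qed auto
  from this[of 1] show ?thesis by simp
qed

text \<open>Finite differences pass under the integral by linearity, so integrability at each point
  of the orthant suffices.\<close>

lemma diff_monotone_integral:
  assumes "\<And>x. x \<in> pos_orthant E \<Longrightarrow> integrable M (\<lambda>\<omega>. g \<omega> x)"
    and "\<And>\<omega>. \<omega> \<in> space M \<Longrightarrow> diff_monotone n E (g \<omega>)"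
  shows "diff_monotone n E (\<lambda>x. \<integral>\<omega>. g \<omega> x \<partial>M)"
  using assms
proof (induction n arbitrary: g)
  case 0
  then show ?case by (auto intro!: Bochner_Integration.integral_nonneg)
next
  case (Suc n)
  have "diff_monotone n E (fdiff e h (\<lambda>x. \<integral>\<omega>. g \<omega> x \<partial>M))" if e: "e \<in> E" and h: "h > 0" for e h
  proof (rule diff_monotone_cong)
    note int = Suc.prems(1) Suc.prems(1)[OF orthant_shift[OF _ e h]]
    show "diff_monotone n E (\<lambda>x. \<integral>\<omega>. fdiff e h (g \<omega>) x \<partial>M)"
    proof (rule Suc.IH)
      show "integrable M (\<lambda>\<omega>. fdiff e h (g \<omega>) x)" if "x \<in> pos_orthant E" for x
        unfolding fdiff_def by (intro Bochner_Integration.integrable_diff int that)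
    qed (use Suc.prems(2) e h in simp)
    show "fdiff e h (\<lambda>x. \<integral>\<omega>. g \<omega> x \<partial>M) x = (\<integral>\<omega>. fdiff e h (g \<omega>) x \<partial>M)"
      if "x \<in> pos_orthant E" for x
      unfolding fdiff_def by (intro Bochner_Integration.integral_diff[symmetric] int that)
  qed
  then show ?case using Suc.prems by (auto intro!: Bochner_Integration.integral_nonneg)
qed

text \<open>An iterated difference involves finitely many points, so it survives pointwise
  convergence. The limit in question is that of difference quotients.\<close>

lemma diff_monotone_lim:
  assumes "\<And>x. x \<in> pos_orthant E \<Longrightarrow> (\<lambda>i. F i x) \<longlonglongrightarrow> f x"
    and "\<And>i. diff_monotone n E (F i)"
  shows "diff_monotone n E f"
  using assms
proof (induction n arbitrary: F f)
  case 0
  have "0 \<le> f x" if "x \<in> pos_orthant E" for x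
    using 0(1)[OF that] by (rule LIMSEQ_le_const) (use diff_monotone_nonneg[OF 0(2) that] in blast)
  then show ?case by simp
next
  case (Suc n)
  have "diff_monotone n E (fdiff e h f)" if e: "e \<in> E" and h: "h > 0" for e h
  proof (rule Suc.IH[of "\<lambda>i. fdiff e h (F i)"])
    show "(\<lambda>i. fdiff e h (F i) x) \<longlonglongrightarrow> fdiff e h f x" if x: "x \<in> pos_orthant E" for x
      unfolding fdiff_def by (rule tendsto_diff[OF Suc.prems(1)[OF x] Suc.prems(1)[OF orthant_shift[OF x e h]]])
  qed (use Suc.prems(2) e h in simp)
  moreover have "0 \<le> f x" if "x \<in> pos_orthant E" for x
    using Suc.prems(1)[OF that] by (rule LIMSEQ_le_const) (use diff_monotone_nonneg[OF Suc.prems(2) that] in blast)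
  ultimately show ?case by simp
qed

section \<open>Smoothness and complete monotonicity\<close>

text \<open>Closed under partial differentiation on the orthant, which makes existence and
  continuity of all iterated derivatives an induction on the list of directions. Positivity in the
  rule \<open>powr\<close> makes the chain rule available there.\<close>

inductive smooth_expr :: "'e set \<Rightarrow> (('e \<Rightarrow> real) \<Rightarrow> real) \<Rightarrow> bool" for E where
  const: "smooth_expr E (\<lambda>x. c)"
| coord: "e \<in> E \<Longrightarrow> smooth_expr E (\<lambda>x. x e)"
| add: "smooth_expr E f \<Longrightarrow> smooth_expr E g \<Longrightarrow> smooth_expr E (\<lambda>x. f x + g x)"
| mult: "smooth_expr E f \<Longrightarrow> smooth_expr E g \<Longrightarrow> smooth_expr E (\<lambda>x. f x * g x)"
| powr: "smooth_expr E f \<Longrightarrow> (\<And>x. x \<in> pos_orthant E \<Longrightarrow> f x > 0) \<Longrightarrow> smooth_expr E (\<lambda>x. f x powr c)"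

lemma smooth_expr_sum:
  "finite K \<Longrightarrow> (\<And>k. k \<in> K \<Longrightarrow> smooth_expr E (f k)) \<Longrightarrow> smooth_expr E (\<lambda>x. \<Sum>k\<in>K. f k x)"
  by (induction K rule: finite_induct) (auto intro: smooth_expr.intros)

lemma smooth_expr_prod:
  "finite K \<Longrightarrow> (\<And>k. k \<in> K \<Longrightarrow> smooth_expr E (f k)) \<Longrightarrow> smooth_expr E (\<lambda>x. \<Prod>k\<in>K. f k x)"
  by (induction K rule: finite_induct) (auto intro: smooth_expr.intros)

lemma smooth_expr_continuous: "smooth_expr E f \<Longrightarrow> continuous_on (pos_orthant E) f"
proof (induction rule: smooth_expr.induct)
  case (coord e)
  show ?case by (rule continuous_on_subset[OF continuous_on_product_coordinates subset_UNIV])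
next
  case (powr f c)
  then have "\<forall>x\<in>pos_orthant E. f x \<noteq> 0" by (metis less_irrefl)
  with powr show ?case by (intro continuous_on_powr continuous_on_const)
qed (auto intro: continuous_intros)

lemma smooth_expr_deriv:
  assumes "smooth_expr E f" "e \<in> E"
  shows "\<exists>g. smooth_expr E g \<and>
    (\<forall>x\<in>pos_orthant E. ((\<lambda>t. f (x(e := t))) has_field_derivative g x) (at (x e)))"
  using assms(1)
proof (induction rule: smooth_expr.induct)
  case (const c)
  show ?case by (rule exI[of _ "\<lambda>x. 0"]) (auto intro: smooth_expr.intros)
next
  case (coord d)
  show ?case
    by (rule exI[of _ "\<lambda>x. if d = e then 1 else 0"]) (cases "d = e"; auto intro: smooth_expr.intros)
next
  case (add f g)
  then obtain f' g' where *: "smooth_expr E f'" "smooth_expr E g'"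
    "\<And>x. x \<in> pos_orthant E \<Longrightarrow> ((\<lambda>t. f (x(e := t))) has_field_derivative f' x) (at (x e))"
    "\<And>x. x \<in> pos_orthant E \<Longrightarrow> ((\<lambda>t. g (x(e := t))) has_field_derivative g' x) (at (x e))"
    by blast
  show ?case
    by (intro exI[of _ "\<lambda>x. f' x + g' x"] conjI ballI smooth_expr.add DERIV_add *)
next
  case (mult f g)
  then obtain f' g' where *: "smooth_expr E f'" "smooth_expr E g'"
    "\<And>x. x \<in> pos_orthant E \<Longrightarrow> ((\<lambda>t. f (x(e := t))) has_field_derivative f' x) (at (x e))"
    "\<And>x. x \<in> pos_orthant E \<Longrightarrow> ((\<lambda>t. g (x(e := t))) has_field_derivative g' x) (at (x e))"
    by blast
  have "smooth_expr E (\<lambda>x. f' x * g x + g' x * f x)"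
    using mult * by (auto intro!: smooth_expr.intros)
  moreover have "((\<lambda>t. f (x(e := t)) * g (x(e := t))) has_field_derivative f' x * g x + g' x * f x) (at (x e))"
    if "x \<in> pos_orthant E" for x
    using DERIV_mult[OF *(3,4)[OF that]] by simp
  ultimately show ?case by blast
next
  case (powr f c)
  then obtain f' where *: "smooth_expr E f'"
    "\<And>x. x \<in> pos_orthant E \<Longrightarrow> ((\<lambda>t. f (x(e := t))) has_field_derivative f' x) (at (x e))"
    by blast
  have "smooth_expr E (\<lambda>x. c * f x powr (c - 1) * f' x)"
    using powr * by (auto intro!: smooth_expr.intros)
  moreover have "((\<lambda>t. f (x(e := t)) powr c) has_field_derivative c * f x powr (c - 1) * f' x) (at (x e))"
    if "x \<in> pos_orthant E" for x
    using DERIV_fun_powr[OF *(2)[OF that], of c] powr(2)[OF that] by simp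
  ultimately show ?case by blast
qed

text \<open>The partial derivative is a limit of difference quotients, so it inherits from \<open>f\<close> the sign of
  all iterated finite differences; no differentiation under an integral is ever needed.\<close>

lemma diff_monotone_deriv:
  assumes f: "\<And>n. diff_monotone n E f" and e: "e \<in> E"
    and g: "\<And>x. x \<in> pos_orthant E \<Longrightarrow> ((\<lambda>t. f (x(e := t))) has_field_derivative g x) (at (x e))"
  shows "diff_monotone n E (\<lambda>x. - g x)"
proof (rule diff_monotone_lim)
  define h :: "nat \<Rightarrow> real" where "h i = 1 / real (Suc i)" for i
  have h: "h i > 0" for i by (simp add: h_def)
  \<comment> \<open>\<open>fdiff\<close> subtracts the shifted value, so its quotients tend to minus
    the derivative.\<close>
  show "diff_monotone n E (\<lambda>x. (1 / h i) * fdiff e (h i) f x)" for i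
    using f[of "Suc n"] h[of i] e by (intro diff_monotone_mult diff_monotone_const) auto
  show "(\<lambda>i. (1 / h i) * fdiff e (h i) f x) \<longlonglongrightarrow> - g x" if "x \<in> pos_orthant E" for x
  proof -
    have "((\<lambda>k. (f (x(e := x e + k)) - f x) / k) \<longlongrightarrow> g x) (at 0)"
      using g[OF that] by (simp add: DERIV_def)
    moreover have "filterlim h (at 0) sequentially"
      using h LIMSEQ_inverse_real_of_nat unfolding h_def[abs_def]
      by (auto simp: filterlim_at inverse_eq_divide intro!: always_eventually)
    ultimately have "(\<lambda>i. (f (x(e := x e + h i)) - f x) / h i) \<longlonglongrightarrow> g x"
      by (rule filterlim_compose)
    from tendsto_minus[OF this] show ?thesis
      by (simp add: fdiff_def diff_divide_distrib)
  qed
qed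

text \<open>The representative g is introduced because iterated derivatives are controlled only
  inside the orthant. The induction carries smoothness and signs together: smoothness of g permits
  the next derivative, which then flips the sign.\<close>

lemma partial_derivs_smooth_expr:
  assumes "smooth_expr E f" "es \<in> lists E"
  shows "\<exists>g. smooth_expr E g \<and> (\<forall>x\<in>pos_orthant E. partial_derivs es f x = g x) \<and>
    ((\<forall>n. diff_monotone n E f) \<longrightarrow> (\<forall>n. diff_monotone n E (\<lambda>x. (-1) ^ length es * g x)))"
  using assms(2)
proof (induction es)
  case Nil
  show ?case using assms(1) by (auto simp: partial_derivs_def)
next
  case (Cons e es)
  then obtain g where g: "smooth_expr E g"
    "\<And>x. x \<in> pos_orthant E \<Longrightarrow> partial_derivs es f x = g x"
    "(\<forall>n. diff_monotone n E f) \<longrightarrow> (\<forall>n. diff_monotone n E (\<lambda>x. (-1) ^ length es * g x))"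
    by auto
  from Cons have e: "e \<in> E" by simp
  obtain g' where g': "smooth_expr E g'"
    "\<And>x. x \<in> pos_orthant E \<Longrightarrow> ((\<lambda>t. g (x(e := t))) has_field_derivative g' x) (at (x e))"
    using smooth_expr_deriv[OF g(1) e] by blast
  have "partial_derivs (e # es) f x = g' x" if x: "x \<in> pos_orthant E" for x
  proof -
    \<comment> \<open>\<open>deriv\<close> depends only on values near x e, and nearby arguments are
      positive, so they stay where the induction hypothesis holds.\<close>
    have "x e > 0" using x e by auto
    then have "eventually (\<lambda>t. t > 0) (nhds (x e))"
    using eventually_nhds_in_open[of "{0<..}" "x e"] by simp
    then have ev: "eventually (\<lambda>t. partial_derivs es f (x(e := t)) = g (x(e := t))) (nhds (x e))"
      by eventually_elim (use g(2) orthant_update[OF x e] in auto)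
    have "partial_derivs (e # es) f x = deriv (\<lambda>t. g (x(e := t))) (x e)"
      unfolding partial_derivs_def foldr_Cons comp_def partial_deriv_def[of e]
      by (rule deriv_cong_ev) (use ev in \<open>simp_all add: partial_derivs_def\<close>)
    then show ?thesis using DERIV_imp_deriv[OF g'(2)[OF x]] by simp
  qed
  moreover have "diff_monotone n E (\<lambda>x. (-1) ^ length (e # es) * g' x)" if "\<forall>n. diff_monotone n E f" for n
    using diff_monotone_deriv[OF g(3)[rule_format, OF that[rule_format]] e DERIV_cmult[OF g'(2)], of n] by simp
  ultimately show ?case using g'(1) by blast
qed

lemma completely_monotoneI:
  assumes f: "smooth_expr E f" and dm: "\<And>n. diff_monotone n E f"
  shows "completely_monotone E f"
  unfolding completely_monotone_def smooth_on_orthant_def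
proof (intro conjI ballI)
  fix es assume es: "es \<in> lists E"
  obtain g where g: "smooth_expr E g"
    "\<And>x. x \<in> pos_orthant E \<Longrightarrow> partial_derivs es f x = g x"
    "\<And>n. diff_monotone n E (\<lambda>x. (-1) ^ length es * g x)"
    using partial_derivs_smooth_expr[OF f es] dm by metis
  show "continuous_on (pos_orthant E) (partial_derivs es f)"
    using continuous_on_cong[OF refl g(2)] smooth_expr_continuous[OF g(1)] by (rule iffD2)
  fix x assume x: "x \<in> pos_orthant E"
  show "0 \<le> (-1) ^ length es * partial_derivs es f x"
    using diff_monotone_nonneg[OF g(3) x] g(2)[OF x] by simp
  fix e assume e: "e \<in> E"
  obtain g' where g': "smooth_expr E g'"
    "\<And>x. x \<in> pos_orthant E \<Longrightarrow> ((\<lambda>t. g (x(e := t))) has_field_derivative g' x) (at (x e))"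
    using smooth_expr_deriv[OF g(1) e] by blast
  have "x e > 0" using x e by auto
  then have "eventually (\<lambda>t. t > 0) (nhds (x e))"
    using eventually_nhds_in_open[of "{0<..}" "x e"] by simp
  then have ev: "eventually (\<lambda>t. partial_derivs es f (x(e := t)) = g (x(e := t))) (nhds (x e))"
    by eventually_elim (use g(2) orthant_update[OF x e] in auto)
  have "((\<lambda>t. partial_derivs es f (x(e := t))) has_field_derivative g' x) (at (x e))"
    by (subst DERIV_cong_ev[OF refl ev refl]) (rule g'(2)[OF x])
  then show "(\<lambda>t. partial_derivs es f (x(e := t))) field_differentiable (at (x e))"
    unfolding field_differentiable_def ..
qed

section \<open>Powers of determinants of Gram matrices\<close>

text \<open>Serves twice: for the vectors v_e with weights x_e, and for the rows of \<open>U\<close>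
  with weights p_k. Equating the two sums of squares translates between x and the pivots.\<close>

lemma norm_sum_squared:
  fixes w :: "'k \<Rightarrow> nat \<Rightarrow> complex" and c :: "'k \<Rightarrow> real"
  assumes "\<And>i j. i < n \<Longrightarrow> j < n \<Longrightarrow> X i j = (\<Sum>k\<in>K. of_real (c k) * cnj (w k i) * w k j)"
  shows "(\<Sum>i<n. \<Sum>j<n. cnj (y i) * X i j * y j) =
    of_real (\<Sum>k\<in>K. c k * (cmod (\<Sum>i<n. w k i * y i))\<^sup>2)"
proof -
  have "of_real (\<Sum>k\<in>K. c k * (cmod (\<Sum>i<n. w k i * y i))\<^sup>2) =
      (\<Sum>k\<in>K. of_real (c k) * (cnj (\<Sum>i<n. w k i * y i) * (\<Sum>j<n. w k j * y j)))"
    by (simp only: of_real_sum of_real_mult complex_norm_square mult.commute[of _ "cnj _"])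
  also have "\<dots> = (\<Sum>k\<in>K. \<Sum>i<n. \<Sum>j<n. cnj (y i) * (of_real (c k) * cnj (w k i) * w k j) * y j)"
    by (simp only: cnj_sum sum_product, simp only: sum_distrib_left, intro sum.cong refl, simp add: mult_ac)
  also have "\<dots> = (\<Sum>i<n. \<Sum>k\<in>K. \<Sum>j<n. cnj (y i) * (of_real (c k) * cnj (w k i) * w k j) * y j)"
    by (rule sum.swap)
  also have "\<dots> = (\<Sum>i<n. \<Sum>j<n. \<Sum>k\<in>K. cnj (y i) * (of_real (c k) * cnj (w k i) * w k j) * y j)"
    by (intro sum.cong refl sum.swap)
  also have "\<dots> = (\<Sum>i<n. \<Sum>j<n. cnj (y i) * X i j * y j)"
    by (intro sum.cong refl) (simp add: assms sum_distrib_left sum_distrib_right)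
  finally show ?thesis ..
qed

text \<open>The real and the complex case are treated uniformly: \<open>F\<close> is the field of the matrix entries,
  embedded into the complex numbers, and \<open>\<nu>\<close>, pushed forward along \<open>\<iota>\<close>, is the Lebesgue measure on \<open>F\<close>
  scaled so that the Gaussian integrals carry no constants.\<close>

locale gaussian_field =
  fixes F :: "complex set" and \<nu> :: "'a measure" and \<iota> :: "'a \<Rightarrow> complex" and \<delta> :: real
  assumes F_zero: "0 \<in> F" and F_one: "1 \<in> F"
    and F_add: "a \<in> F \<Longrightarrow> b \<in> F \<Longrightarrow> a + b \<in> F" and F_diff: "a \<in> F \<Longrightarrow> b \<in> F \<Longrightarrow> a - b \<in> F"
    and F_mult: "a \<in> F \<Longrightarrow> b \<in> F \<Longrightarrow> a * b \<in> F" and F_divide: "a \<in> F \<Longrightarrow> b \<in> F \<Longrightarrow> a / b \<in> F"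
    and F_cnj: "a \<in> F \<Longrightarrow> cnj a \<in> F" and F_real: "of_real s \<in> F"
    and sigma_finite: "sigma_finite_measure \<nu>"
    and \<iota>_measurable [measurable]: "\<iota> \<in> borel_measurable \<nu>"
    and \<iota>_F: "\<iota> t \<in> F"
    and gaussian: "s > 0 \<Longrightarrow> b \<in> F \<Longrightarrow>
      (\<integral>\<^sup>+t. ennreal (exp (- (s * (cmod (\<iota> t + b))\<^sup>2))) \<partial>\<nu>) = ennreal (s powr - \<delta>)"
begin

lemma F_sum: "(\<And>k. k \<in> K \<Longrightarrow> f k \<in> F) \<Longrightarrow> (\<Sum>k\<in>K. f k) \<in> F"
  by (induction K rule: infinite_finite_induct) (auto intro: F_zero F_add)

text \<open>Elimination starts with the last coordinate: removing the rank-one part of the pivot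
  \<open>X n n\<close> leaves the Schur complement \<open>S\<close> on the first n coordinates. Row
  k of \<open>U\<close> then involves only coordinates up to k, so that the Gaussian variables can
  later be integrated from the last one downwards.\<close>

lemma hermitian_factorization:
  fixes X :: "nat \<Rightarrow> nat \<Rightarrow> complex"
  assumes "\<And>i j. i < n \<Longrightarrow> j < n \<Longrightarrow> X j i = cnj (X i j)"
    and "\<And>i j. i < n \<Longrightarrow> j < n \<Longrightarrow> X i j \<in> F"
    and "\<And>y i. i < n \<Longrightarrow> y i \<noteq> 0 \<Longrightarrow> 0 < Re (\<Sum>i<n. \<Sum>j<n. cnj (y i) * X i j * y j)"
  shows "\<exists>p U. (\<forall>k<n. p k > 0) \<and> (\<forall>k. U k k = 1) \<and> (\<forall>k i. k < i \<longrightarrow> U k i = 0) \<and>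
    (\<forall>k i. U k i \<in> F) \<and>
    (\<forall>i<n. \<forall>j<n. X i j = (\<Sum>k<n. of_real (p k) * cnj (U k i) * U k j))"
  using assms
proof (induction n arbitrary: X)
  case 0
  show ?case
    by (rule exI[of _ "\<lambda>k. 1"], rule exI[of _ "\<lambda>k i. if i = k then 1 else 0"])
      (auto simp: F_zero F_one)
next
  case (Suc n)
  note herm = Suc.prems(1) and XF = Suc.prems(2) and pd = Suc.prems(3)
  define a where "a = Re (X n n)"
  have Xnn: "X n n = of_real a"
    using herm[of n n] unfolding a_def by (simp add: complex_eq_iff)
  \<comment> \<open>Testing positivity on the last unit vector shows that the pivot is
    positive.\<close>
  have "0 < Re (\<Sum>i<Suc n. \<Sum>j<Suc n. cnj (if i = n then 1 else 0) * X i j * (if j = n then 1 else 0))"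
    by (rule pd[of n]) auto
  then have a: "a > 0"
    by (simp add: if_distrib[of "\<lambda>c. c * _"] if_distrib[of "\<lambda>c. _ * c"] a_def if_distrib[of cnj] cong: if_cong)
  define S where "S i j = X i j - X i n * X n j / of_real a" for i j
  have S_pd: "0 < Re (\<Sum>i<n. \<Sum>j<n. cnj (y i) * S i j * y j)" if "i < n" "y i \<noteq> 0" for y i
  proof -
    define w where "w = (\<Sum>j<n. X n j * y j)"
    have cw: "(\<Sum>i<n. cnj (y i) * X i n) = cnj w"
      unfolding w_def cnj_sum by (intro sum.cong refl) (simp add: herm[of n] mult.commute)
    \<comment> \<open>Completing the square: this last coordinate minimizes the form for given
      \<open>y\<close>, and the minimum is the form of \<open>S\<close> at \<open>y\<close>.\<close>
    define z where "z = y(n := - w / of_real a)"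
    have z: "z n = - w / of_real a" "j < n \<Longrightarrow> z j = y j" for j by (auto simp: z_def)
    have "(\<Sum>i<Suc n. \<Sum>j<Suc n. cnj (z i) * X i j * z j) =
        (\<Sum>i<n. \<Sum>j<n. cnj (y i) * X i j * y j) + (\<Sum>i<n. cnj (y i) * X i n) * z n
        + cnj (z n) * w + cnj (z n) * of_real a * z n"
      by (simp add: z(2) sum.distrib w_def sum_distrib_left sum_distrib_right mult.assoc Xnn)
    also have "\<dots> = (\<Sum>i<n. \<Sum>j<n. cnj (y i) * X i j * y j) - cnj w * w / of_real a"
      using a by (simp add: z(1) cw field_simps)
    also have "cnj w * w / of_real a = (\<Sum>i<n. \<Sum>j<n. cnj (y i) * (X i n * X n j / of_real a) * y j)"
    proof -
      have "cnj w * w = (\<Sum>i<n. cnj (y i) * X i n) * (\<Sum>j<n. X n j * y j)"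
        by (simp only: cw w_def)
      then show ?thesis
        unfolding sum_product by (simp only: sum_divide_distrib) (intro sum.cong refl, simp)
    qed
    also have "(\<Sum>i<n. \<Sum>j<n. cnj (y i) * X i j * y j) - \<dots> = (\<Sum>i<n. \<Sum>j<n. cnj (y i) * S i j * y j)"
      unfolding S_def by (simp add: sum_subtractf[symmetric] algebra_simps)
    finally have eq: "(\<Sum>i<Suc n. \<Sum>j<Suc n. cnj (z i) * X i j * z j) =
      (\<Sum>i<n. \<Sum>j<n. cnj (y i) * S i j * y j)" .
    have "0 < Re (\<Sum>i<Suc n. \<Sum>j<Suc n. cnj (z i) * X i j * z j)"
      using that z(2)[of i] by (intro pd[of i]) auto
    then show ?thesis unfolding eq .
  qed
  have "\<exists>p U. (\<forall>k<n. p k > 0) \<and> (\<forall>k. U k k = 1) \<and> (\<forall>k i. k < i \<longrightarrow> U k i = 0) \<and>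
    (\<forall>k i. U k i \<in> F) \<and>
    (\<forall>i<n. \<forall>j<n. S i j = (\<Sum>k<n. of_real (p k) * cnj (U k i) * U k j))"
  proof (rule Suc.IH[of S])
    show "S j i = cnj (S i j)" if "i < n" "j < n" for i j
      using that by (simp add: S_def herm[of i j] herm[of n j] herm[of i n] mult.commute)
    show "S i j \<in> F" if "i < n" "j < n" for i j
      using that unfolding S_def by (intro F_diff F_mult F_divide F_real XF) auto
  qed (rule S_pd; assumption)
  then obtain p U where p: "\<And>k. k < n \<Longrightarrow> p k > 0" and U: "\<And>k. U k k = 1" "\<And>k i. k < i \<Longrightarrow> U k i = 0"
    "\<And>k i. U k i \<in> F"
    and SU: "\<And>i j. i < n \<Longrightarrow> j < n \<Longrightarrow> S i j = (\<Sum>k<n. of_real (p k) * cnj (U k i) * U k j)"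
    by blast
  define p' where "p' = p(n := a)"
  define U' where "U' = U(n := \<lambda>i. if i \<le> n then X n i / of_real a else 0)"
  have low: "p' k = p k" "U' k = U k" if "k < n" for k using that by (auto simp: p'_def U'_def)
  have XU: "X i j = (\<Sum>k<Suc n. of_real (p' k) * cnj (U' k i) * U' k j)" if "i < Suc n" "j < Suc n" for i j
  proof -
    have "of_real (p' n) * cnj (U' n i) * U' n j = X i n * X n j / of_real a"
      using that a by (simp add: p'_def U'_def herm[of n i])
    moreover have "(\<Sum>k<n. of_real (p' k) * cnj (U' k i) * U' k j) =
        X i j - X i n * X n j / of_real a"
    proof (cases "i < n \<and> j < n")
      case True
      then show ?thesis using SU[of i j] by (simp add: low S_def)
    next
      \<comment> \<open>In the last row or column the old rows contribute nothing, since they vanish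
        beyond their diagonal; the new row alone reproduces \<open>X\<close>.\<close>
      case False
      then have "(\<Sum>k<n. of_real (p' k) * cnj (U' k i) * U' k j) = 0"
        by (intro sum.neutral) (auto simp: low intro!: U(2))
      moreover have "i = n \<or> j = n" using False that by auto
      then have "X i j - X i n * X n j / of_real a = 0" using a by (auto simp: Xnn)
      ultimately show ?thesis by simp
    qed
    ultimately show ?thesis by simp
  qed
  have p': "p' k > 0" if "k < Suc n" for k using p a that by (auto simp: p'_def less_Suc_eq)
  have U1: "U' k k = 1" for k using U(1) a by (simp add: U'_def Xnn)
  have U0: "U' k i = 0" if "k < i" for k i using U(2) that by (simp add: U'_def)
  have UF: "U' k i \<in> F" for k i
    using U(3) by (auto simp: U'_def F_zero intro!: F_divide F_real XF)
  show ?case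
    by (intro exI[of _ p'] exI[of _ U'] conjI allI impI) (rule p' U1 U0 UF XU; assumption)+
qed

end

lemma det_factorization:
  fixes p :: "nat \<Rightarrow> real"
  assumes "\<And>k. U k k = 1" "\<And>k i. k < i \<Longrightarrow> U k i = 0"
    and X: "\<And>i j. i < n \<Longrightarrow> j < n \<Longrightarrow> X i j = (\<Sum>k<n. of_real (p k) * cnj (U k i) * U k j)"
  shows "Determinant.det (mat n n (\<lambda>(i, j). X i j)) = complex_of_real (\<Prod>k<n. p k)"
proof -
  define A where "A = mat n n (\<lambda>(i, k). of_real (p k) * cnj (U k i))"
  define B where "B = mat n n (\<lambda>(k, j). U k j)"
  have carr: "A \<in> carrier_mat n n" "B \<in> carrier_mat n n" by (auto simp: A_def B_def)
  have "mat n n (\<lambda>(i, j). X i j) = A * B"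
    by (rule eq_matI) (auto simp: A_def B_def X scalar_prod_def lessThan_atLeast0)
  then have "Determinant.det (mat n n (\<lambda>(i, j). X i j)) = Determinant.det A * Determinant.det B"
    using det_mult[OF carr] by simp
  also have "Determinant.det A = prod_list (diag_mat A)"
    by (rule det_upper_triangular[OF _ carr(1)]) (auto simp: A_def assms(2))
  also have "prod_list (diag_mat A) = of_real (\<Prod>k<n. p k)"
    by (simp add: diag_mat_def A_def assms(1) prod.list_conv_set_nth lessThan_atLeast0)
  also have "Determinant.det B = prod_list (diag_mat B)"
    by (rule det_lower_triangular[OF _ carr(2)]) (auto simp: B_def assms(2))
  also have "prod_list (diag_mat B) = 1"
    by (simp add: diag_mat_def B_def assms(1) prod.list_conv_set_nth)
  finally show ?thesis by simp
qed

section \<open>Gaussian and Gamma integrals\<close>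

context gaussian_field
begin

lemma product_sigma_finite_\<nu>: "product_sigma_finite (\<lambda>_::nat. \<nu>)"
  by (simp add: product_sigma_finite_def sigma_finite)

text \<open>The centre of the j-th Gaussian depends only on variables of smaller index. Integrating
  the largest index first leaves the other terms untouched, and the translation invariance built
  into \<open>gaussian\<close> makes the result independent of the centre.\<close>

lemma gaussian_iterated:
  fixes p :: "nat \<Rightarrow> real" and z :: "nat \<Rightarrow> complex"
  assumes p: "\<And>j. k < j \<Longrightarrow> j < m \<Longrightarrow> p j > 0" and z: "\<And>j. z j \<in> F" and U: "\<And>i j. U i j \<in> F"
  shows "(\<integral>\<^sup>+t. ennreal (exp (- (\<Sum>j\<in>{k<..<m}. p j *
      (cmod (\<iota> (t j) + (z j + (\<Sum>i\<in>{k<..<j}. U j i * \<iota> (t i)))))\<^sup>2))) \<partial>(\<Pi>\<^sub>M i\<in>{k<..<m}. \<nu>))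
    = ennreal (\<Prod>j\<in>{k<..<m}. p j powr - \<delta>)"
  using p
proof (induction m)
  case 0
  interpret product_sigma_finite "\<lambda>_::nat. \<nu>" by (rule product_sigma_finite_\<nu>)
  show ?case by (simp add: nn_integral_empty del: nn_integral_const)
next
  case (Suc m)
  interpret product_sigma_finite "\<lambda>_::nat. \<nu>" by (rule product_sigma_finite_\<nu>)
  define G where "G t j = p j * (cmod (\<iota> (t j) + (z j + (\<Sum>i\<in>{k<..<j}. U j i * \<iota> (t i)))))\<^sup>2" for t :: "nat \<Rightarrow> 'a" and j
  show ?case
  proof (cases "k < m")
    case False
    then have "{k<..<Suc m} = {}" by auto
    then show ?thesis by (simp add: nn_integral_empty del: nn_integral_const)
  next
    case True
    then have ins: "{k<..<Suc m} = insert m {k<..<m}" by auto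
    have pm: "p m > 0" using Suc.prems[of m] True by simp
    have G_meas: "(\<lambda>t. G t j) \<in> borel_measurable (\<Pi>\<^sub>M i\<in>{k<..<Suc m}. \<nu>)" if "j \<in> {k<..<Suc m}" for j
    proof -
      have [measurable]: "(\<lambda>t. \<iota> (t i)) \<in> borel_measurable (\<Pi>\<^sub>M i\<in>{k<..<Suc m}. \<nu>)" if "i \<in> {k<..j}" for i
        by (rule measurable_compose[OF measurable_component_singleton[of i _ "\<lambda>_. \<nu>"] \<iota>_measurable])
          (use that \<open>j \<in> {k<..<Suc m}\<close> in auto)
      show ?thesis
        unfolding G_def using that by measurable
    qed
    have upd: "G (t(m := s)) j = G t j" if "j < m" for t s j
      using that unfolding G_def by (auto intro!: arg_cong[where f="\<lambda>x. p j * (cmod x)\<^sup>2"] sum.cong)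
    have "(\<integral>\<^sup>+t. ennreal (exp (- (\<Sum>j\<in>{k<..<Suc m}. G t j))) \<partial>(\<Pi>\<^sub>M i\<in>{k<..<Suc m}. \<nu>)) =
        (\<integral>\<^sup>+t. (\<integral>\<^sup>+s. ennreal (exp (- (\<Sum>j\<in>{k<..<Suc m}. G (t(m := s)) j))) \<partial>\<nu>) \<partial>(\<Pi>\<^sub>M i\<in>{k<..<m}. \<nu>))"
      unfolding ins
    proof (rule product_nn_integral_insert)
      show "(\<lambda>t. ennreal (exp (- (\<Sum>j\<in>insert m {k<..<m}. G t j)))) \<in> borel_measurable (\<Pi>\<^sub>M i\<in>insert m {k<..<m}. \<nu>)"
        using G_meas unfolding ins by measurable
    qed auto
    also have "\<dots> = (\<integral>\<^sup>+t. ennreal (p m powr - \<delta>) * ennreal (exp (- (\<Sum>j\<in>{k<..<m}. G t j))) \<partial>(\<Pi>\<^sub>M i\<in>{k<..<m}. \<nu>))"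
    proof (rule nn_integral_cong)
      fix t :: "nat \<Rightarrow> 'a"
      define b where "b = z m + (\<Sum>i\<in>{k<..<m}. U m i * \<iota> (t i))"
      have b: "b \<in> F" unfolding b_def by (intro F_add z F_sum F_mult U \<iota>_F)
      have Gm: "G (t(m := s)) m = p m * (cmod (\<iota> s + b))\<^sup>2" for s
        unfolding G_def b_def by (auto intro!: arg_cong[where f="\<lambda>x. p m * (cmod x)\<^sup>2"] sum.cong)
      have "(\<Sum>j\<in>{k<..<Suc m}. G (t(m := s)) j) = p m * (cmod (\<iota> s + b))\<^sup>2 + (\<Sum>j\<in>{k<..<m}. G t j)" for s
        unfolding ins using upd by (simp add: Gm)
      then have "(\<integral>\<^sup>+s. ennreal (exp (- (\<Sum>j\<in>{k<..<Suc m}. G (t(m := s)) j))) \<partial>\<nu>) =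
          (\<integral>\<^sup>+s. ennreal (exp (- (p m * (cmod (\<iota> s + b))\<^sup>2))) * ennreal (exp (- (\<Sum>j\<in>{k<..<m}. G t j))) \<partial>\<nu>)"
        by (simp add: exp_add[symmetric] ennreal_mult[symmetric])
      also have "\<dots> = ennreal (p m powr - \<delta>) * ennreal (exp (- (\<Sum>j\<in>{k<..<m}. G t j)))"
        by (subst nn_integral_multc) (simp_all add: gaussian[OF pm b])
      finally show "(\<integral>\<^sup>+s. ennreal (exp (- (\<Sum>j\<in>{k<..<Suc m}. G (t(m := s)) j))) \<partial>\<nu>) = \<dots>" .
    qed
    also have "\<dots> = ennreal (p m powr - \<delta>) * (\<integral>\<^sup>+t. ennreal (exp (- (\<Sum>j\<in>{k<..<m}. G t j))) \<partial>(\<Pi>\<^sub>M i\<in>{k<..<m}. \<nu>))"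
    proof (rule nn_integral_cmult)
      have [measurable]: "(\<lambda>t. G t j) \<in> borel_measurable (\<Pi>\<^sub>M i\<in>{k<..<m}. \<nu>)" if "j \<in> {k<..<m}" for j
      proof -
        have [measurable]: "(\<lambda>t. \<iota> (t i)) \<in> borel_measurable (\<Pi>\<^sub>M i\<in>{k<..<m}. \<nu>)" if "i \<in> {k<..j}" for i
          by (rule measurable_compose[OF measurable_component_singleton[of i _ "\<lambda>_. \<nu>"] \<iota>_measurable])
            (use that \<open>j \<in> {k<..<m}\<close> in auto)
        show ?thesis unfolding G_def using that by measurable
      qed
      show "(\<lambda>t. ennreal (exp (- (\<Sum>j\<in>{k<..<m}. G t j)))) \<in> borel_measurable (\<Pi>\<^sub>M i\<in>{k<..<m}. \<nu>)"
        by measurable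
    qed
    also have "(\<integral>\<^sup>+t. ennreal (exp (- (\<Sum>j\<in>{k<..<m}. G t j))) \<partial>(\<Pi>\<^sub>M i\<in>{k<..<m}. \<nu>)) =
        ennreal (\<Prod>j\<in>{k<..<m}. p j powr - \<delta>)"
      unfolding G_def by (rule Suc.IH) (use Suc.prems in auto)
    finally show ?thesis
      unfolding G_def[symmetric] ins by (simp add: ennreal_mult prod_nonneg)
  qed
qed

end

text \<open>The Gamma integral after the substitution t = p s. It exhibits p to the power -\<gamma>
  as a mixture, with nonnegative weights, of the functions exp (- s p).\<close>

lemma powr_neg_Gamma_integral:
  assumes "p > 0" "\<gamma> > 0"
  shows "has_bochner_integral lborel
    (\<lambda>s::real. indicator {0..} s * s powr (\<gamma> - 1) / Gamma \<gamma> * exp (- (s * p))) (p powr - \<gamma>)"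
proof (rule has_bochner_integral_nn_integral)
  let ?f = "\<lambda>s::real. indicator {0..} s * s powr (\<gamma> - 1) / Gamma \<gamma> * exp (- (s * p))"
  have G: "Gamma \<gamma> > 0" using assms by (simp add: Gamma_real_pos)
  then have G0: "Gamma \<gamma> \<noteq> 0" by simp
  show "?f \<in> borel_measurable lborel" by measurable
  show "AE s in lborel. 0 \<le> ?f s" using G by (simp add: zero_le_mult_iff)
  show "0 \<le> p powr - \<gamma>" by simp
  let ?g = "\<lambda>t::real. ennreal (indicator {0..} t * t powr (\<gamma> - 1) / exp t)"
  have "ennreal (Gamma \<gamma>) = (\<integral>\<^sup>+t. ?g t \<partial>lborel)"
    by (rule Gamma_conv_nn_integral_real[OF assms(2)])
  also have "\<dots> = ennreal \<bar>p\<bar> * (\<integral>\<^sup>+s. ?g (0 + p * s) \<partial>lborel)"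
    by (rule nn_integral_real_affine) (use assms in auto)
  also have "(\<integral>\<^sup>+s. ?g (0 + p * s) \<partial>lborel) = (\<integral>\<^sup>+s. ennreal (p powr (\<gamma> - 1) * Gamma \<gamma>) * ennreal (?f s) \<partial>lborel)"
  proof (rule nn_integral_cong)
    fix s :: real
    have "indicator {0..} (0 + p * s) * (0 + p * s) powr (\<gamma> - 1) / exp (0 + p * s) =
        p powr (\<gamma> - 1) * Gamma \<gamma> * ?f s"
      using assms G0 by (auto simp: indicator_def zero_le_mult_iff powr_mult exp_minus field_simps)
    then show "?g (0 + p * s) = ennreal (p powr (\<gamma> - 1) * Gamma \<gamma>) * ennreal (?f s)"
      using G by (simp only: ennreal_mult'[symmetric] mult_nonneg_nonneg powr_ge_zero less_imp_le)
  qed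
  also have "\<dots> = ennreal (p powr (\<gamma> - 1) * Gamma \<gamma>) * (\<integral>\<^sup>+s. ennreal (?f s) \<partial>lborel)"
    by (rule nn_integral_cmult) measurable
  finally have eq: "ennreal (Gamma \<gamma>) = ennreal (p powr \<gamma> * Gamma \<gamma>) * (\<integral>\<^sup>+s. ennreal (?f s) \<partial>lborel)"
    using assms G by (simp add: mult.assoc[symmetric] ennreal_mult[symmetric] powr_diff)
  have "ennreal (p powr - \<gamma> / Gamma \<gamma>) * ennreal (Gamma \<gamma>) =
      (ennreal (p powr - \<gamma> / Gamma \<gamma>) * ennreal (p powr \<gamma> * Gamma \<gamma>)) * (\<integral>\<^sup>+s. ennreal (?f s) \<partial>lborel)"
    by (subst eq) (simp only: mult.assoc)
  moreover have "ennreal (p powr - \<gamma> / Gamma \<gamma>) * ennreal (Gamma \<gamma>) = ennreal (p powr - \<gamma>)"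
    using G G0 assms by (simp add: ennreal_mult[symmetric])
  moreover have "ennreal (p powr - \<gamma> / Gamma \<gamma>) * ennreal (p powr \<gamma> * Gamma \<gamma>) = 1"
    using G G0 assms by (simp add: ennreal_mult[symmetric] powr_add[symmetric])
  ultimately show "(\<integral>\<^sup>+s. ennreal (?f s) \<partial>lborel) = ennreal (p powr - \<gamma>)" by simp
qed

context gaussian_field
begin

text \<open>Read through \<open>v\<close>, the integrand is for each t an exponential linear in x
  with nonnegative coefficients, so it has the required signs. Read through \<open>U\<close>, the
  same exponent splits into s p_k and a triangular Gaussian in the remaining variables, so the
  integral over t is known.\<close>

lemma gaussian_stage:
  fixes v :: "'e \<Rightarrow> nat \<Rightarrow> complex" and p :: "('e \<Rightarrow> real) \<Rightarrow> nat \<Rightarrow> real"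
  assumes fin: "finite E" and k: "k < N" and s: "s \<ge> 0"
    and p: "\<And>x j. x \<in> pos_orthant E \<Longrightarrow> j < N \<Longrightarrow> p x j > 0"
    and U1: "\<And>x j. x \<in> pos_orthant E \<Longrightarrow> U x j j = 1"
    and U0: "\<And>x j i. x \<in> pos_orthant E \<Longrightarrow> j < i \<Longrightarrow> U x j i = 0"
    and UF: "\<And>x j i. x \<in> pos_orthant E \<Longrightarrow> U x j i \<in> F"
    and fact: "\<And>x i j. x \<in> pos_orthant E \<Longrightarrow> i < N \<Longrightarrow> j < N \<Longrightarrow>
      (\<Sum>e\<in>E. of_real (x e) * cnj (v e i) * v e j) = (\<Sum>k<N. of_real (p x k) * cnj (U x k i) * U x k j)"
  shows "diff_monotone n E (\<lambda>x. exp (- (s * p x k)) * (\<Prod>j\<in>{k<..<N}. p x j powr - \<delta>))"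
proof -
  define M where "M = (\<Pi>\<^sub>M i\<in>{k<..<N}. \<nu>)"
  \<comment> \<open>The square root gives the k-th entry the squared modulus s, the variable of the
    later Gamma integral.\<close>
  define Y where "Y t i = (if i < k then 0 else if i = k then of_real (sqrt s) else \<iota> (t i))"
    for t :: "nat \<Rightarrow> 'a" and i
  define c where "c t e = (cmod (\<Sum>i<N. v e i * Y t i))\<^sup>2" for t e
  have quad: "(\<Sum>e\<in>E. x e * c t e) = s * p x k + (\<Sum>j\<in>{k<..<N}. p x j *
      (cmod (\<iota> (t j) + (U x j k * of_real (sqrt s) + (\<Sum>i\<in>{k<..<j}. U x j i * \<iota> (t i)))))\<^sup>2)"
    if x: "x \<in> pos_orthant E" for x t
  proof -
    have "complex_of_real (\<Sum>e\<in>E. x e * c t e) =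
        (\<Sum>i<N. \<Sum>j<N. cnj (Y t i) * (\<Sum>k<N. of_real (p x k) * cnj (U x k i) * U x k j) * Y t j)"
      unfolding c_def by (rule norm_sum_squared[symmetric]) (simp add: fact[OF x])
    also have "\<dots> = of_real (\<Sum>j<N. p x j * (cmod (\<Sum>i<N. U x j i * Y t i))\<^sup>2)"
      by (rule norm_sum_squared) simp
    finally have "(\<Sum>e\<in>E. x e * c t e) = (\<Sum>j<N. p x j * (cmod (\<Sum>i<N. U x j i * Y t i))\<^sup>2)"
      by (simp only: of_real_eq_iff)
    also have "\<dots> = (\<Sum>j\<in>insert k {k<..<N}. p x j * (cmod (\<Sum>i<N. U x j i * Y t i))\<^sup>2)"
    proof (rule sum.mono_neutral_right)
      \<comment> \<open>Row j of \<open>U\<close> ends at its diagonal, and \<open>Y\<close>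
        vanishes before k.\<close>
      have "(\<Sum>i<N. U x j i * Y t i) = 0" if "j < k" for j
      proof (rule sum.neutral, rule ballI)
        show "U x j i * Y t i = 0" for i using U0[OF x, of j i] that by (cases "i < k") (auto simp: Y_def)
      qed
      then show "\<forall>j\<in>{..<N} - insert k {k<..<N}. p x j * (cmod (\<Sum>i<N. U x j i * Y t i))\<^sup>2 = 0" by auto
    qed (use k in auto)
    also have "\<dots> = p x k * (cmod (\<Sum>i<N. U x k i * Y t i))\<^sup>2 +
        (\<Sum>j\<in>{k<..<N}. p x j * (cmod (\<Sum>i<N. U x j i * Y t i))\<^sup>2)"
      by simp
    also have "(\<Sum>i<N. U x k i * Y t i) = (\<Sum>i\<in>{k}. U x k i * Y t i)"
      by (rule sum.mono_neutral_right) (use k U0[OF x] in \<open>auto simp: Y_def\<close>)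
    also have "p x k * (cmod \<dots>)\<^sup>2 = s * p x k"
      using s by (simp add: U1[OF x] Y_def norm_of_real)
    also have "(\<Sum>j\<in>{k<..<N}. p x j * (cmod (\<Sum>i<N. U x j i * Y t i))\<^sup>2) = (\<Sum>j\<in>{k<..<N}. p x j *
      (cmod (\<iota> (t j) + (U x j k * of_real (sqrt s) + (\<Sum>i\<in>{k<..<j}. U x j i * \<iota> (t i)))))\<^sup>2)"
    proof (rule sum.cong[OF refl])
      fix j assume j: "j \<in> {k<..<N}"
      have "(\<Sum>i<N. U x j i * Y t i) = (\<Sum>i\<in>insert j (insert k {k<..<j}). U x j i * Y t i)"
        by (rule sum.mono_neutral_right) (use j U0[OF x, of j] in \<open>auto simp: Y_def\<close>)
      also have "\<dots> = \<iota> (t j) + (U x j k * of_real (sqrt s) + (\<Sum>i\<in>{k<..<j}. U x j i * Y t i))"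
        using j by (simp add: U1[OF x] Y_def)
      also have "(\<Sum>i\<in>{k<..<j}. U x j i * Y t i) = (\<Sum>i\<in>{k<..<j}. U x j i * \<iota> (t i))"
        by (rule sum.cong) (auto simp: Y_def)
      finally show "p x j * (cmod (\<Sum>i<N. U x j i * Y t i))\<^sup>2 = p x j *
        (cmod (\<iota> (t j) + (U x j k * of_real (sqrt s) + (\<Sum>i\<in>{k<..<j}. U x j i * \<iota> (t i)))))\<^sup>2"
        by simp
    qed
    finally show ?thesis .
  qed
  have Y_meas: "(\<lambda>t. Y t i) \<in> borel_measurable M" if "i < N" for i
  proof (cases "k < i")
    case True
    have "(\<lambda>t. \<iota> (t i)) \<in> borel_measurable M"
      unfolding M_def
      by (rule measurable_compose[OF measurable_component_singleton[of i _ "\<lambda>_. \<nu>"] \<iota>_measurable])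
        (use that True in auto)
    then show ?thesis using True by (simp add: Y_def)
  next
    case False
    then have "(\<lambda>t. Y t i) = (\<lambda>t. if i < k then 0 else of_real (sqrt s))" by (auto simp: Y_def)
    then show ?thesis by simp
  qed
  have c_meas: "(\<lambda>t. c t e) \<in> borel_measurable M" for e
    unfolding c_def using Y_meas by measurable
  have int: "has_bochner_integral M (\<lambda>t. exp (- (\<Sum>e\<in>E. x e * c t e)))
      (exp (- (s * p x k)) * (\<Prod>j\<in>{k<..<N}. p x j powr - \<delta>))" if x: "x \<in> pos_orthant E" for x
  proof (rule has_bochner_integral_nn_integral)
    show "(\<lambda>t. exp (- (\<Sum>e\<in>E. x e * c t e))) \<in> borel_measurable M"
      using c_meas by measurable
    define D where "D t = (\<Sum>j\<in>{k<..<N}. p x j *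
      (cmod (\<iota> (t j) + (U x j k * of_real (sqrt s) + (\<Sum>i\<in>{k<..<j}. U x j i * \<iota> (t i)))))\<^sup>2)" for t
    have D: "D t = (\<Sum>e\<in>E. x e * c t e) - s * p x k" for t
      unfolding quad[OF x] D_def by simp
    have D_meas: "D \<in> borel_measurable M"
      unfolding D[abs_def] using c_meas by measurable
    have "(\<integral>\<^sup>+t. ennreal (exp (- (\<Sum>e\<in>E. x e * c t e))) \<partial>M) =
        (\<integral>\<^sup>+t. ennreal (exp (- (s * p x k))) * ennreal (exp (- D t)) \<partial>M)"
      by (rule nn_integral_cong) (simp add: D ennreal_mult[symmetric] exp_add[symmetric])
    also have "\<dots> = ennreal (exp (- (s * p x k))) * (\<integral>\<^sup>+t. ennreal (exp (- D t)) \<partial>M)"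
      by (rule nn_integral_cmult) (use D_meas in measurable)
    also have "(\<integral>\<^sup>+t. ennreal (exp (- D t)) \<partial>M) = ennreal (\<Prod>j\<in>{k<..<N}. p x j powr - \<delta>)"
      unfolding M_def D_def by (rule gaussian_iterated) (use p[OF x] UF[OF x] in \<open>auto intro!: F_mult F_real\<close>)
    finally show "(\<integral>\<^sup>+t. ennreal (exp (- (\<Sum>e\<in>E. x e * c t e))) \<partial>M) =
        ennreal (exp (- (s * p x k)) * (\<Prod>j\<in>{k<..<N}. p x j powr - \<delta>))"
      by (simp add: ennreal_mult prod_nonneg)
  qed (auto intro!: mult_nonneg_nonneg prod_nonneg)
  show ?thesis
  proof (rule diff_monotone_cong)
    show "exp (- (s * p x k)) * (\<Prod>j\<in>{k<..<N}. p x j powr - \<delta>) =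
        (\<integral>t. exp (- (\<Sum>e\<in>E. x e * c t e)) \<partial>M)" if "x \<in> pos_orthant E" for x
      using has_bochner_integral_integral_eq[OF int[OF that]] by simp
    show "diff_monotone n E (\<lambda>x. \<integral>t. exp (- (\<Sum>e\<in>E. x e * c t e)) \<partial>M)"
    proof (rule diff_monotone_integral)
      show "diff_monotone n E (\<lambda>x. exp (- (\<Sum>e\<in>E. x e * c t e)))" for t
        by (rule diff_monotone_exp[OF fin]) (simp add: c_def)
    qed (rule integrable.intros[OF int], assumption)
  qed
qed

text \<open>Integration over s against the Gamma weight turns exp (- s p) into the power of p. At
  \<gamma> = 0 the Gamma integral diverges, so this case is read off from s = 0, where p powr 0 is 1
  because p is positive.\<close>

lemma gamma_stage:
  fixes p :: "('e \<Rightarrow> real) \<Rightarrow> real"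
  assumes p: "\<And>x. x \<in> pos_orthant E \<Longrightarrow> p x > 0" and \<gamma>: "\<gamma> \<ge> 0"
    and dm: "\<And>s. s \<ge> 0 \<Longrightarrow> diff_monotone n E (\<lambda>x. exp (- (s * p x)) * w x)"
  shows "diff_monotone n E (\<lambda>x. p x powr - \<gamma> * w x)"
proof (cases "\<gamma> = 0")
  case True
  show ?thesis
    by (rule diff_monotone_cong[OF _ dm[of 0]]) (simp_all add: True p less_imp_neq[OF p, THEN not_sym])
next
  case False
  with \<gamma> have \<gamma>: "\<gamma> > 0" by simp
  let ?h = "\<lambda>s::real. indicator {0..} s * s powr (\<gamma> - 1) / Gamma \<gamma>"
  have h: "?h s \<ge> 0" for s using Gamma_real_pos[OF \<gamma>] by simp
  have int: "has_bochner_integral lborel (\<lambda>s. ?h s * (exp (- (s * p x)) * w x)) (p x powr - \<gamma> * w x)"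
    if "x \<in> pos_orthant E" for x
    using has_bochner_integral_mult_left[OF powr_neg_Gamma_integral[OF p[OF that] \<gamma>], of "w x"]
    by (simp add: mult.assoc)
  show ?thesis
  proof (rule diff_monotone_cong)
    show "p x powr - \<gamma> * w x = (\<integral>s. ?h s * (exp (- (s * p x)) * w x) \<partial>lborel)"
      if "x \<in> pos_orthant E" for x
      using has_bochner_integral_integral_eq[OF int[OF that]] by simp
    show "diff_monotone n E (\<lambda>x. \<integral>s. ?h s * (exp (- (s * p x)) * w x) \<partial>lborel)"
    proof (rule diff_monotone_integral)
      show "diff_monotone n E (\<lambda>x. ?h s * (exp (- (s * p x)) * w x))" for s
      proof (cases "s \<ge> 0")
        case True
        show ?thesis by (rule diff_monotone_mult[OF diff_monotone_const[OF h] dm[OF True]])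
      next
        case False
        then have eq: "(\<lambda>x. ?h s * (exp (- (s * p x)) * w x)) = (\<lambda>x. 0)" by (simp add: fun_eq_iff)
        show ?thesis unfolding eq by (rule diff_monotone_const) simp
      qed
    qed (rule integrable.intros[OF int], assumption)
  qed
qed

text \<open>\<open>span\<close> excludes a nonzero y orthogonal to all the vectors, which makes the
  weighted Gram matrix positive definite at every point of the orthant and so gives access to the
  factorization.\<close>

theorem det_diff_monotone:
  fixes v :: "'e \<Rightarrow> nat \<Rightarrow> complex"
  assumes fin: "finite E" and vF: "\<And>e i. e \<in> E \<Longrightarrow> i < N \<Longrightarrow> v e i \<in> F"
    and span: "\<And>y i. (\<And>e. e \<in> E \<Longrightarrow> (\<Sum>i<N. v e i * y i) = 0) \<Longrightarrow> i < N \<Longrightarrow> y i = 0"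
    and P: "\<And>x. x \<in> pos_orthant E \<Longrightarrow> complex_of_real (P x) =
      Determinant.det (mat N N (\<lambda>(i, j). \<Sum>e\<in>E. of_real (x e) * cnj (v e i) * v e j))"
    and \<beta>: "(\<exists>m::nat. \<beta> = real m * \<delta>) \<or> \<beta> \<ge> (real N - 1) * \<delta>" and \<delta>: "\<delta> \<ge> 0"
  shows "(\<forall>x\<in>pos_orthant E. P x > 0) \<and> diff_monotone n E (\<lambda>x. P x powr - \<beta>)"
proof -
  define X where "X x i j = (\<Sum>e\<in>E. complex_of_real (x e) * cnj (v e i) * v e j)" for x i j
  define Q where "Q x p U \<longleftrightarrow> (\<forall>k<N. p k > 0) \<and> (\<forall>k. U k k = 1) \<and> (\<forall>k i. k < i \<longrightarrow> U k i = 0) \<and>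
    (\<forall>k i. U k i \<in> F) \<and>
    (\<forall>i<N. \<forall>j<N. X x i j = (\<Sum>k<N. of_real (p k) * cnj (U k i) * U k j))" for x p U
  have ex: "\<exists>p U. Q x p U" if x: "x \<in> pos_orthant E" for x
    unfolding Q_def
  proof (rule hermitian_factorization[of N "X x"])
    show "X x j i = cnj (X x i j)" for i j
      unfolding X_def cnj_sum by (intro sum.cong refl) (simp add: mult_ac)
    show "X x i j \<in> F" if "i < N" "j < N" for i j
      unfolding X_def by (intro F_sum F_mult F_real F_cnj vF that)
    fix y :: "nat \<Rightarrow> complex" and i assume i: "i < N" "y i \<noteq> 0"
    then obtain e where e: "e \<in> E" "(\<Sum>i<N. v e i * y i) \<noteq> 0" using span[of y i] by blast
    have pos: "x e > 0" if "e \<in> E" for e using x that by auto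
    have "(\<Sum>i<N. \<Sum>j<N. cnj (y i) * X x i j * y j) =
        of_real (\<Sum>e\<in>E. x e * (cmod (\<Sum>i<N. v e i * y i))\<^sup>2)"
      by (rule norm_sum_squared) (simp add: X_def)
    moreover have "0 < (\<Sum>e\<in>E. x e * (cmod (\<Sum>i<N. v e i * y i))\<^sup>2)"
    proof (rule sum_pos2[OF fin e(1)])
      show "0 < x e * (cmod (\<Sum>i<N. v e i * y i))\<^sup>2" using e pos by simp
      show "0 \<le> x e * (cmod (\<Sum>i<N. v e i * y i))\<^sup>2" if "e \<in> E" for e
        using pos[OF that] by simp
    qed
    ultimately show "0 < Re (\<Sum>i<N. \<Sum>j<N. cnj (y i) * X x i j * y j)" by simp
  qed
  \<comment> \<open>An arbitrary choice at each x separately is harmless, because signs of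
    differences involve values only.\<close>
  define p where "p x = (SOME p. \<exists>U. Q x p U)" for x
  define U where "U x = (SOME U. Q x (p x) U)" for x
  have Q: "Q x (p x) (U x)" if "x \<in> pos_orthant E" for x
    unfolding U_def using someI_ex[OF ex[OF that], folded p_def] by (rule someI_ex)
  have p: "p x k > 0" if "x \<in> pos_orthant E" "k < N" for x k
    using Q[OF that(1)] that(2) unfolding Q_def by blast
  have U: "U x k k = 1" "k < i \<Longrightarrow> U x k i = 0" "U x k i \<in> F" if "x \<in> pos_orthant E" for x k i
    using Q[OF that] unfolding Q_def by blast+
  have XU: "X x i j = (\<Sum>k<N. of_real (p x k) * cnj (U x k i) * U x k j)"
    if "x \<in> pos_orthant E" "i < N" "j < N" for x i j
    using Q[OF that(1)] that(2,3) unfolding Q_def by blast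
  have Pp: "P x = (\<Prod>k<N. p x k)" if x: "x \<in> pos_orthant E" for x
  proof -
    have "complex_of_real (P x) = of_real (\<Prod>k<N. p x k)"
      unfolding P[OF x] X_def[symmetric] by (rule det_factorization[of "U x"]) (use U[OF x] XU[OF x] in auto)
    then show ?thesis by (simp only: of_real_eq_iff)
  qed
  have factor: "diff_monotone n E (\<lambda>x. p x k powr - \<gamma> * (\<Prod>j\<in>{k<..<N}. p x j powr - \<delta>))"
    if k: "k < N" and \<gamma>: "\<gamma> \<ge> 0" for k \<gamma>
  proof (rule gamma_stage)
    show "diff_monotone n E (\<lambda>x. exp (- (s * p x k)) * (\<Prod>j\<in>{k<..<N}. p x j powr - \<delta>))" if "s \<ge> 0" for s
      by (rule gaussian_stage[OF fin k that]) (rule p U XU[unfolded X_def]; assumption)+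
  qed (use p k \<gamma> in auto)
  have pos: "P x > 0" if "x \<in> pos_orthant E" for x
    unfolding Pp[OF that] using p[OF that] by (auto intro!: prod_pos)
  have P_powr: "P x powr a = (\<Prod>k<N. p x k powr a)" if "x \<in> pos_orthant E" for x a
    unfolding Pp[OF that] by (rule prod_powr_distrib)
  from \<beta> have "diff_monotone n E (\<lambda>x. P x powr - \<beta>)"
  proof
    assume "\<exists>m::nat. \<beta> = real m * \<delta>"
    then obtain m :: nat where m: "\<beta> = real m * \<delta>" by blast
    have "diff_monotone n E (\<lambda>x. P x powr - \<delta>)"
    proof (cases "N = 0")
      \<comment> \<open>The determinant of order 0 is 1, and there is no pivot 0 to build a factor
        from.\<close>
      case True
      show ?thesis
        by (rule diff_monotone_cong[OF _ diff_monotone_const[of 1]]) (use P_powr True in auto)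
    next
      case False
      have "{..<N} = insert 0 {0<..<N}" using False by auto
      then show ?thesis
        using False \<delta> by (intro diff_monotone_cong[OF _ factor[of 0 \<delta>]]) (auto simp: P_powr)
    qed
    then have "diff_monotone n E (\<lambda>x. (P x powr - \<delta>) ^ m)" by (rule diff_monotone_power)
    then show ?thesis
      by (rule diff_monotone_cong[rotated]) (simp add: m pos powr_power mult.commute less_imp_neq[THEN not_sym])
  next
    assume ge: "\<beta> \<ge> (real N - 1) * \<delta>"
    have nonneg: "\<beta> - real k * \<delta> \<ge> 0" if "k < N" for k
      using mult_right_mono[OF _ \<delta>, of "real k" "real N - 1"] that ge by linarith
    have "diff_monotone n E
        (\<lambda>x. \<Prod>k<N. p x k powr - (\<beta> - real k * \<delta>) * (\<Prod>j\<in>{k<..<N}. p x j powr - \<delta>))"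
    proof (rule diff_monotone_prod[OF finite_lessThan])
      fix k assume "k \<in> {..<N}"
      then have k: "k < N" by simp
      show "diff_monotone n E (\<lambda>x. p x k powr - (\<beta> - real k * \<delta>) * (\<Prod>j\<in>{k<..<N}. p x j powr - \<delta>))"
        by (rule factor[OF k nonneg[OF k]])
    qed
    moreover have "P x powr - \<beta> = (\<Prod>k<N. p x k powr - (\<beta> - real k * \<delta>) * (\<Prod>j\<in>{k<..<N}. p x j powr - \<delta>))"
      if x: "x \<in> pos_orthant E" for x
    proof -
      \<comment> \<open>Double counting: p_j receives the exponent -\<delta> from each of the j
        factors with k < j, and its own factor supplies the rest, -(\<beta> - j \<delta>).\<close>
      have "(\<Prod>k<N. \<Prod>j\<in>{k<..<N}. p x j powr - \<delta>) = (\<Prod>k<N. \<Prod>j\<in>{j\<in>{..<N}. k < j}. p x j powr - \<delta>)"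
        by (intro prod.cong refl) auto
      also have "\<dots> = (\<Prod>j<N. \<Prod>k\<in>{k\<in>{..<N}. k < j}. p x j powr - \<delta>)"
        by (rule prod.swap_restrict) auto
      also have "\<dots> = (\<Prod>j<N. p x j powr - (real j * \<delta>))"
      proof (rule prod.cong[OF refl])
        fix j assume j: "j \<in> {..<N}"
        then have "{k\<in>{..<N}. k < j} = {..<j}" by auto
        then show "(\<Prod>k\<in>{k\<in>{..<N}. k < j}. p x j powr - \<delta>) = p x j powr - (real j * \<delta>)"
          using p[OF x, of j] j by (simp add: powr_power mult.commute)
      qed
      finally have "(\<Prod>k<N. p x k powr - (\<beta> - real k * \<delta>) * (\<Prod>j\<in>{k<..<N}. p x j powr - \<delta>)) =
          (\<Prod>k<N. p x k powr - (\<beta> - real k * \<delta>) * p x k powr - (real k * \<delta>))"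
        by (simp add: prod.distrib)
      also have "\<dots> = (\<Prod>k<N. p x k powr - \<beta>)"
        by (intro prod.cong refl) (simp add: powr_add[symmetric])
      finally show ?thesis using P_powr[OF x] by simp
    qed
    ultimately show ?thesis by (rule diff_monotone_cong[rotated])
  qed
  with pos show ?thesis by blast
qed

end

lemma gaussian_nn_integral:
  assumes "s > 0"
  shows "(\<integral>\<^sup>+t. ennreal (exp (- (s * (sqrt pi * t + b)\<^sup>2))) \<partial>lborel) = ennreal (s powr - (1 / 2))"
proof -
  \<comment> \<open>A normal density with mean -b / sqrt pi and variance 1 / (2 pi s) has the
    exponent of the integrand. The scaling by sqrt pi cancels the usual constant of the Gaussian
    integral.\<close>
  define \<sigma> where "\<sigma> = 1 / sqrt (2 * pi * s)"
  have \<sigma>: "\<sigma> > 0" "\<sigma>\<^sup>2 = 1 / (2 * pi * s)"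
    using assms by (simp_all add: \<sigma>_def power_divide)
  have "exp (- (s * (sqrt pi * t + b)\<^sup>2)) = s powr - (1 / 2) * normal_density (- b / sqrt pi) \<sigma> t" for t
  proof -
    have "s * (sqrt pi * t + b)\<^sup>2 = (t - - b / sqrt pi)\<^sup>2 / (2 * \<sigma>\<^sup>2)"
    proof -
      have "sqrt pi * t + b = sqrt pi * (t - - b / sqrt pi)" by (simp add: field_simps)
      then show ?thesis using assms by (simp only: power_mult_distrib \<sigma>(2)) (simp add: field_simps)
    qed
    moreover have "1 / sqrt (2 * pi * \<sigma>\<^sup>2) = sqrt s"
      using assms by (simp add: \<sigma>(2) real_sqrt_divide)
    ultimately show ?thesis
      using assms by (simp add: normal_density_def powr_minus powr_half_sqrt)
  qed
  then have "(\<integral>\<^sup>+t. ennreal (exp (- (s * (sqrt pi * t + b)\<^sup>2))) \<partial>lborel) =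
      (\<integral>\<^sup>+t. ennreal (s powr - (1 / 2)) * ennreal (normal_density (- b / sqrt pi) \<sigma> t) \<partial>lborel)"
    by (simp add: ennreal_mult)
  also have "\<dots> = ennreal (s powr - (1 / 2)) * (\<integral>\<^sup>+t. ennreal (normal_density (- b / sqrt pi) \<sigma> t) \<partial>lborel)"
    by (rule nn_integral_cmult) simp
  also have "(\<integral>\<^sup>+t. ennreal (normal_density (- b / sqrt pi) \<sigma> t) \<partial>lborel) = 1"
    using \<sigma>(1) by (subst nn_integral_eq_integral) auto
  finally show ?thesis by simp
qed

section \<open>The real and the complex field\<close>

lemma gaussian_field_real: "gaussian_field \<real> lborel (\<lambda>t::real. complex_of_real (sqrt pi * t)) (1 / 2)"
proof
  fix s :: real and b :: complex assume s: "s > 0" and "b \<in> \<real>"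
  then obtain b' where b: "b = of_real b'" by (auto elim: Reals_cases)
  have "(cmod (complex_of_real (sqrt pi * t) + b))\<^sup>2 = (sqrt pi * t + b')\<^sup>2" for t
    unfolding b of_real_add[symmetric] norm_of_real by simp
  then show "(\<integral>\<^sup>+t. ennreal (exp (- (s * (cmod (complex_of_real (sqrt pi * t) + b))\<^sup>2))) \<partial>lborel) =
      ennreal (s powr - (1 / 2))"
    using gaussian_nn_integral[OF s, of b'] by simp
qed (auto simp: Reals_cnj_iff intro: lborel.sigma_finite_countable)

text \<open>The squared modulus splits into real and imaginary parts, so the integral is a product
  of two real ones, each contributing the exponent -1/2.\<close>

lemma gaussian_field_complex:
  "gaussian_field UNIV (lborel \<Otimes>\<^sub>M lborel) (\<lambda>t::real \<times> real. Complex (sqrt pi * fst t) (sqrt pi * snd t)) 1"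
proof (rule gaussian_field.intro)
  show "sigma_finite_measure (lborel \<Otimes>\<^sub>M lborel :: (real \<times> real) measure)"
    unfolding lborel_prod by (rule lborel.sigma_finite_measure_axioms)
  show "(\<lambda>t::real \<times> real. Complex (sqrt pi * fst t) (sqrt pi * snd t)) \<in> borel_measurable (lborel \<Otimes>\<^sub>M lborel)"
    unfolding Complex_eq by measurable
  fix s :: real and b :: complex assume s: "s > 0"
  let ?f = "\<lambda>(c::real) t. ennreal (exp (- (s * (sqrt pi * t + c)\<^sup>2)))"
  have "(\<integral>\<^sup>+t. ennreal (exp (- (s * (cmod (Complex (sqrt pi * fst t) (sqrt pi * snd t) + b))\<^sup>2)))
      \<partial>(lborel \<Otimes>\<^sub>M lborel)) = (\<integral>\<^sup>+t. ?f (Re b) (fst t) * ?f (Im b) (snd t) \<partial>(lborel \<Otimes>\<^sub>M lborel))"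
    by (intro nn_integral_cong) (simp add: cmod_power2 ennreal_mult[symmetric] exp_add[symmetric] algebra_simps)
  also have "\<dots> = (\<integral>\<^sup>+t. (\<integral>\<^sup>+u. ?f (Re b) t * ?f (Im b) u \<partial>lborel) \<partial>lborel)"
    by (subst lborel.nn_integral_fst[symmetric]) auto
  also have "\<dots> = ennreal (s powr - (1 / 2)) * ennreal (s powr - (1 / 2))"
    by (simp add: nn_integral_cmult nn_integral_multc gaussian_nn_integral[OF s])
  also have "\<dots> = ennreal (s powr - 1)"
    by (simp add: ennreal_mult[symmetric] powr_add[symmetric])
  finally show "(\<integral>\<^sup>+t. ennreal (exp (- (s * (cmod (Complex (sqrt pi * fst t) (sqrt pi * snd t) + b))\<^sup>2)))
      \<partial>(lborel \<Otimes>\<^sub>M lborel)) = ennreal (s powr - 1)" .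
qed auto

section \<open>The Cauchy-Binet formula\<close>

lemma permutes_less: "\<sigma> permutes {0..<r} \<Longrightarrow> i < r \<Longrightarrow> \<sigma> i < (r::nat)"
  using permutes_in_image[of \<sigma> "{0..<r}" i] by simp

text \<open>Expanding the product of the row sums gives one term for each map f from rows to E. A
  map that is not injective repeats a row of the matrix of w, so its signed sum vanishes; the
  injective maps are grouped by their image S.\<close>

lemma cauchy_binet:
  fixes u w :: "'e \<Rightarrow> nat \<Rightarrow> 'k::comm_ring_1"
  assumes fin: "finite E"
    and en: "\<And>S. S \<subseteq> E \<Longrightarrow> card S = r \<Longrightarrow> bij_betw (en S) {0..<r} S"
  shows "Determinant.det (mat r r (\<lambda>(i, j). \<Sum>e\<in>E. x e * u e i * w e j)) =
    (\<Sum>S | S \<subseteq> E \<and> card S = r. (\<Prod>e\<in>S. x e) *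
      Determinant.det (mat r r (\<lambda>(i, j). u (en S i) j)) * Determinant.det (mat r r (\<lambda>(i, j). w (en S i) j)))"
proof -
  let ?R = "{0..<r}" and ?\<SS> = "{S. S \<subseteq> E \<and> card S = r}"
  let ?W = "\<lambda>f. Determinant.det (mat r r (\<lambda>(i, j). w (f i) j))"
  define T where "T f = (\<Prod>i\<in>?R. x (f i)) * (\<Prod>i\<in>?R. u (f i) i) * ?W f" for f
  define I where "I = {f \<in> ?R \<rightarrow>\<^sub>E E. inj_on f ?R}"
  have fin_PiE: "finite (?R \<rightarrow>\<^sub>E E)" using fin by (intro finite_PiE) auto
  have "Determinant.det (mat r r (\<lambda>(i, j). \<Sum>e\<in>E. x e * u e i * w e j)) =
      (\<Sum>\<sigma> | \<sigma> permutes ?R. signof \<sigma> * (\<Prod>i\<in>?R. \<Sum>e\<in>E. x e * u e i * w e (\<sigma> i)))"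
    by (subst det_def'[of _ r]) (auto intro!: sum.cong prod.cong simp: permutes_less)
  also have "\<dots> = (\<Sum>\<sigma> | \<sigma> permutes ?R. \<Sum>f\<in>?R \<rightarrow>\<^sub>E E. signof \<sigma> * (\<Prod>i\<in>?R. x (f i) * u (f i) i * w (f i) (\<sigma> i)))"
    by (subst prod_sum_PiE) (auto simp: fin sum_distrib_left)
  also have "\<dots> = (\<Sum>f\<in>?R \<rightarrow>\<^sub>E E. \<Sum>\<sigma> | \<sigma> permutes ?R. signof \<sigma> * (\<Prod>i\<in>?R. x (f i) * u (f i) i * w (f i) (\<sigma> i)))"
    by (rule sum.swap)
  also have "\<dots> = (\<Sum>f\<in>?R \<rightarrow>\<^sub>E E. T f)"
  proof (rule sum.cong[OF refl])
    fix f
    have "?W f = (\<Sum>\<sigma> | \<sigma> permutes ?R. signof \<sigma> * (\<Prod>i\<in>?R. w (f i) (\<sigma> i)))"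
      by (subst det_def'[of _ r]) (auto intro!: sum.cong prod.cong simp: permutes_less)
    then show "(\<Sum>\<sigma> | \<sigma> permutes ?R. signof \<sigma> * (\<Prod>i\<in>?R. x (f i) * u (f i) i * w (f i) (\<sigma> i))) = T f"
      unfolding T_def by (simp add: sum_distrib_left prod.distrib mult_ac)
  qed
  also have "\<dots> = sum T I"
  proof (rule sum.mono_neutral_right[OF fin_PiE])
    show "\<forall>f\<in>(?R \<rightarrow>\<^sub>E E) - I. T f = 0"
    proof
      fix f assume "f \<in> (?R \<rightarrow>\<^sub>E E) - I"
      then obtain i j where ij: "i < r" "j < r" "i \<noteq> j" "f i = f j" by (auto simp: I_def inj_on_def)
      have "?W f = 0"
        by (rule det_identical_rows[of _ r i j]) (use ij in \<open>auto intro!: eq_vecI\<close>)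
      then show "T f = 0" by (simp add: T_def)
    qed
  qed (auto simp: I_def)
  also have "\<dots> = (\<Sum>S\<in>?\<SS>. \<Sum>f | f \<in> I \<and> f ` ?R = S. T f)"
    by (rule sum.group[symmetric]) (use fin fin_PiE in \<open>auto simp: I_def card_image\<close>)
  also have "\<dots> = (\<Sum>S\<in>?\<SS>. (\<Prod>e\<in>S. x e) *
      Determinant.det (mat r r (\<lambda>(i, j). u (en S i) j)) * ?W (en S))"
  proof (rule sum.cong[OF refl])
    fix S assume "S \<in> ?\<SS>"
    then have S: "S \<subseteq> E" "card S = r" by auto
    note bij = en[OF S]
    have en_S: "en S i \<in> S" if "i < r" for i using bij that by (auto simp: bij_betw_def)
    define pos where "pos = inv_into ?R (en S)"
    have pos: "pos e < r" "en S (pos e) = e" if "e \<in> S" for e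
      using bij_betw_apply[OF bij_betw_inv_into[OF bij] that] bij_betw_inv_into_right[OF bij that]
      by (simp_all add: pos_def)
    have pos_en: "pos (en S i) = i" if "i < r" for i
      using bij_betw_inv_into_left[OF bij, of i] that by (simp add: pos_def)
    have "(\<Sum>f | f \<in> I \<and> f ` ?R = S. T f) =
        (\<Sum>\<sigma> | \<sigma> permutes ?R. (\<Prod>e\<in>S. x e) * (signof \<sigma> * (\<Prod>i\<in>?R. u (en S (\<sigma> i)) i)) * ?W (en S))"
    \<comment> \<open>Each f with image S is a unique permutation followed by the enumeration
      \<open>en S\<close>. Undoing the permutation in \<open>?W f\<close> costs the sign that
      completes the determinant of the minor of u.\<close>
    proof (rule sum.reindex_bij_witness[where
          i = "\<lambda>\<sigma>. restrict (\<lambda>i. en S (\<sigma> i)) ?R" and j = "\<lambda>f i. if i < r then pos (f i) else i"])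
      fix f assume "f \<in> {f. f \<in> I \<and> f ` ?R = S}"
      then have f: "f \<in> ?R \<rightarrow>\<^sub>E E" "inj_on f ?R" "f ` ?R = S" by (auto simp: I_def)
      have fS: "f i \<in> S" if "i < r" for i using f(3) that by auto
      let ?\<sigma> = "\<lambda>i. if i < r then pos (f i) else i"
      show "restrict (\<lambda>i. en S (?\<sigma> i)) ?R = f"
        using f(1) pos fS by (auto simp: fun_eq_iff PiE_def extensional_def)
      have "inj_on ?\<sigma> ?R"
      proof (rule inj_onI)
        fix i j assume ij: "i \<in> ?R" "j \<in> ?R" "?\<sigma> i = ?\<sigma> j"
        then have "pos (f i) = pos (f j)" by simp
        moreover have "i < r" "j < r" using ij by auto
        ultimately have "f i = f j" using pos(2)[OF fS[of i]] pos(2)[OF fS[of j]] by metis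
        with f(2) ij(1,2) show "i = j" by (auto dest: inj_onD)
      qed
      moreover have "?\<sigma> ` ?R \<subseteq> ?R" using pos(1) fS by auto
      ultimately have "bij_betw ?\<sigma> ?R ?R"
        unfolding bij_betw_def using endo_inj_surj[of ?R ?\<sigma>] by blast
      then have perm: "?\<sigma> permutes ?R"
        by (rule bij_imp_permutes) simp
      then show "?\<sigma> \<in> {\<sigma>. \<sigma> permutes ?R}" by simp
      have f_eq: "f i = en S (?\<sigma> i)" if "i < r" for i using pos(2)[OF fS[OF that]] that by simp
      have "(\<Prod>i\<in>?R. x (f i)) = (\<Prod>e\<in>S. x e)"
        using f(2,3) by (subst prod.reindex_cong[of f ?R S x "\<lambda>i. x (f i)"]) auto
      moreover have "(\<Prod>i\<in>?R. u (f i) i) = (\<Prod>i\<in>?R. u (en S (?\<sigma> i)) i)"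
        by (rule prod.cong) (use f_eq in auto)
      moreover have "?W f = signof ?\<sigma> * ?W (en S)"
      proof -
        have "mat r r (\<lambda>(i, j). w (f i) j) = mat r r (\<lambda>(i, j). mat r r (\<lambda>(i, j). w (en S i) j) $$ (?\<sigma> i, j))"
          using f_eq permutes_less[OF perm] by (intro eq_matI) auto
        then show ?thesis
          using det_permute_rows[OF _ perm, of "mat r r (\<lambda>(i, j). w (en S i) j)"] by simp
      qed
      ultimately show "(\<Prod>e\<in>S. x e) * (signof ?\<sigma> * (\<Prod>i\<in>?R. u (en S (?\<sigma> i)) i)) * ?W (en S) = T f"
        unfolding T_def by (simp add: mult_ac)
    next
      fix \<sigma> assume "\<sigma> \<in> {\<sigma>. \<sigma> permutes ?R}"
      then have \<sigma>: "\<sigma> permutes ?R" by simp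
      note less = permutes_less[OF \<sigma>]
      show "(\<lambda>i. if i < r then pos (restrict (\<lambda>i. en S (\<sigma> i)) ?R i) else i) = \<sigma>"
        using pos_en less permutes_not_in[OF \<sigma>] by (auto simp: fun_eq_iff)
      have bij': "bij_betw (\<lambda>i. en S (\<sigma> i)) ?R S"
        using bij_betw_trans[OF permutes_imp_bij[OF \<sigma>] bij] by (simp add: comp_def)
      show "restrict (\<lambda>i. en S (\<sigma> i)) ?R \<in> {f. f \<in> I \<and> f ` ?R = S}"
        using bij' S(1) by (auto simp: I_def bij_betw_def inj_on_def)
    qed
    also have "\<dots> = (\<Prod>e\<in>S. x e) * (\<Sum>\<sigma> | \<sigma> permutes ?R. signof \<sigma> * (\<Prod>i\<in>?R. u (en S (\<sigma> i)) i)) * ?W (en S)"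
      by (simp add: sum_distrib_left sum_distrib_right)
    also have "(\<Sum>\<sigma> | \<sigma> permutes ?R. signof \<sigma> * (\<Prod>i\<in>?R. u (en S (\<sigma> i)) i)) =
        Determinant.det (mat r r (\<lambda>(i, j). u (en S i) j))"
      by (subst det_col[of _ r]) (auto intro!: sum.cong prod.cong simp: permutes_less lessThan_atLeast0)
    finally show "(\<Sum>f | f \<in> I \<and> f ` ?R = S. T f) = (\<Prod>e\<in>S. x e) *
      Determinant.det (mat r r (\<lambda>(i, j). u (en S i) j)) * ?W (en S)" .
  qed
  finally show ?thesis .
qed

text \<open>Cauchy-Binet with the conjugate of \<open>v\<close> as left family: a subset contributes
  the squared modulus of its minor, which is the indicator of the set family.\<close>

lemma basis_sum_eq_det:
  fixes v :: "'e \<Rightarrow> nat \<Rightarrow> complex"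
  assumes fin: "finite E" and \<B>: "\<And>S. S \<in> \<B> \<Longrightarrow> S \<subseteq> E \<and> card S = r"
    and minor: "\<And>es. distinct es \<Longrightarrow> set es \<subseteq> E \<Longrightarrow> length es = r \<Longrightarrow>
      cmod (Determinant.det (mat r r (\<lambda>(i, j). v (es ! i) j))) ^ 2 = (if set es \<in> \<B> then 1 else 0)"
  shows "complex_of_real (\<Sum>S\<in>\<B>. \<Prod>e\<in>S. x e) =
    Determinant.det (mat r r (\<lambda>(i, j). \<Sum>e\<in>E. of_real (x e) * cnj (v e i) * v e j))"
proof -
  define en where "en S = (!) (SOME es. distinct es \<and> set es = S)" for S :: "'e set"
  have en: "\<exists>es. distinct es \<and> set es = S \<and> length es = r \<and> en S = (!) es" if S: "S \<subseteq> E" "card S = r" for S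
  proof -
    have "finite S" using S(1) fin by (rule finite_subset)
    then have "\<exists>es. distinct es \<and> set es = S" using finite_distinct_list by blast
    note someI_ex[OF this]
    moreover from this have "length (SOME es. distinct es \<and> set es = S) = r"
      using S(2) distinct_card[of "SOME es. distinct es \<and> set es = S"] by simp
    ultimately show ?thesis
      by (intro exI[of _ "SOME es. distinct es \<and> set es = S"]) (simp add: en_def)
  qed
  let ?W = "\<lambda>S. Determinant.det (mat r r (\<lambda>(i, j). v (en S i) j))"
  have bij: "bij_betw (en S) {0..<r} S" if S: "S \<subseteq> E" "card S = r" for S
  proof -
    obtain es where "distinct es" "set es = S" "length es = r" "en S = (!) es" using en[OF S] by blast
    then show ?thesis using bij_betw_nth[of es "{0..<r}" S] by (simp add: lessThan_atLeast0)
  qed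
  have "Determinant.det (mat r r (\<lambda>(i, j). \<Sum>e\<in>E. of_real (x e) * cnj (v e i) * v e j)) =
    (\<Sum>S | S \<subseteq> E \<and> card S = r. (\<Prod>e\<in>S. complex_of_real (x e)) *
      Determinant.det (mat r r (\<lambda>(i, j). cnj (v (en S i) j))) * ?W S)"
    using cauchy_binet[OF fin bij, where x = "\<lambda>e. complex_of_real (x e)" and u = "\<lambda>e i. cnj (v e i)" and w = v] .
  also have "\<dots> = (\<Sum>S | S \<subseteq> E \<and> card S = r. if S \<in> \<B> then \<Prod>e\<in>S. complex_of_real (x e) else 0)"
  proof (rule sum.cong[OF refl])
    fix S assume "S \<in> {S. S \<subseteq> E \<and> card S = r}"
    then have S: "S \<subseteq> E" "card S = r" by auto
    have "Determinant.det (mat r r (\<lambda>(i, j). cnj (v (en S i) j))) = cnj (?W S)"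
    proof -
      interpret cnj: comm_ring_hom cnj by unfold_locales auto
      have "mat r r (\<lambda>(i, j). cnj (v (en S i) j)) = map_mat cnj (mat r r (\<lambda>(i, j). v (en S i) j))"
        by (intro eq_matI) auto
      then show ?thesis by simp
    qed
    then have "Determinant.det (mat r r (\<lambda>(i, j). cnj (v (en S i) j))) * ?W S = of_real ((cmod (?W S))\<^sup>2)"
      by (simp only: complex_norm_square mult.commute[of "cnj _"])
    also have "(cmod (?W S))\<^sup>2 = (if S \<in> \<B> then 1 else 0)"
    proof -
      obtain es where "distinct es" "set es = S" "length es = r" "en S = (!) es" using en[OF S] by blast
      then show ?thesis using minor[of es] S by simp
    qed
    finally show "(\<Prod>e\<in>S. complex_of_real (x e)) *
        Determinant.det (mat r r (\<lambda>(i, j). cnj (v (en S i) j))) * ?W S =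
        (if S \<in> \<B> then \<Prod>e\<in>S. complex_of_real (x e) else 0)"
      by (simp add: mult.assoc)
  qed
  also have "\<dots> = (\<Sum>S\<in>\<B>. \<Prod>e\<in>S. complex_of_real (x e))"
  proof (rule sum.mono_neutral_cong_right)
    show "finite {S. S \<subseteq> E \<and> card S = r}" using fin by simp
  qed (use \<B> in auto)
  finally show ?thesis by simp
qed

section \<open>From minors to complete monotonicity\<close>

lemma smooth_expr_sum_prod:
  assumes "finite E" "\<And>S. S \<in> \<B> \<Longrightarrow> f S \<subseteq> E" "finite \<B>"
  shows "smooth_expr E (\<lambda>x. \<Sum>S\<in>\<B>. \<Prod>e\<in>f S. x e)"
  by (rule smooth_expr_sum[OF assms(3)], rule smooth_expr_prod)
    (use assms finite_subset in \<open>blast intro: smooth_expr.coord\<close>)+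

lemma nonsingular_kernel:
  fixes A :: "'k::field mat"
  assumes A: "A = mat r r (\<lambda>(i, j). a i j)" and det: "Determinant.det A \<noteq> 0"
    and "\<And>i. i < r \<Longrightarrow> (\<Sum>j<r. a i j * y j) = 0" and i: "i < r"
  shows "y i = 0"
proof -
  have "A *\<^sub>v vec r y = 0\<^sub>v r"
    using assms by (intro eq_vecI) (auto simp: scalar_prod_def lessThan_atLeast0)
  moreover have "A \<in> carrier_mat r r" by (simp add: A)
  ultimately have "vec r y = 0\<^sub>v r"
    using det det_0_iff_vec_prod_zero[of A r] vec_carrier[of r y] by blast
  from arg_cong[OF this, of "\<lambda>w. w $ i"] i show ?thesis by simp
qed

context gaussian_field
begin

text \<open>Only the minors enter, so real and complex representations and the integral coordinates
  of graphs are all handled here.\<close>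

lemma completely_monotone_basis_sum:
  fixes v :: "'e \<Rightarrow> nat \<Rightarrow> complex"
  assumes fin: "finite E" and \<B>: "\<And>S. S \<in> \<B> \<Longrightarrow> S \<subseteq> E \<and> card S = r" and ne: "\<B> \<noteq> {}"
    and vF: "\<And>e i. e \<in> E \<Longrightarrow> i < r \<Longrightarrow> v e i \<in> F"
    and minor: "\<And>es. distinct es \<Longrightarrow> set es \<subseteq> E \<Longrightarrow> length es = r \<Longrightarrow>
      cmod (Determinant.det (mat r r (\<lambda>(i, j). v (es ! i) j))) ^ 2 = (if set es \<in> \<B> then 1 else 0)"
    and \<beta>: "(\<exists>m::nat. \<beta> = real m * \<delta>) \<or> \<beta> \<ge> (real r - 1) * \<delta>" and \<delta>: "\<delta> \<ge> 0"
  shows "completely_monotone E (\<lambda>x. (\<Sum>S\<in>\<B>. \<Prod>e\<in>S. x e) powr - \<beta>)"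
proof -
  \<comment> \<open>One basis is enough: its nonzero minor forces the vectors to span.\<close>
  obtain S es where S: "S \<in> \<B>" "distinct es" "set es = S" "length es = r" "S \<subseteq> E"
    using ne \<B> fin finite_distinct_list finite_subset distinct_card by (metis equals0I)
  then have det: "Determinant.det (mat r r (\<lambda>(i, j). v (es ! i) j)) \<noteq> 0"
    using minor[of es] by auto
  have span: "y i = 0" if 0: "\<And>e. e \<in> E \<Longrightarrow> (\<Sum>i<r. v e i * y i) = 0" and i: "i < r" for y i
  proof (rule nonsingular_kernel[OF refl det _ i])
    fix k assume "k < r"
    then have "es ! k \<in> E" using S nth_mem[of k es] by auto
    then show "(\<Sum>j<r. v (es ! k) j * y j) = 0" by (rule 0)
  qed
  have pos: "(\<forall>x\<in>pos_orthant E. (\<Sum>S\<in>\<B>. \<Prod>e\<in>S. x e) > 0) \<and>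
      diff_monotone n E (\<lambda>x. (\<Sum>S\<in>\<B>. \<Prod>e\<in>S. x e) powr - \<beta>)" for n
    by (rule det_diff_monotone[OF fin vF _ _ \<beta> \<delta>])
      ((assumption | rule span basis_sum_eq_det[OF fin \<B> minor] | blast)+)
  have "finite \<B>" using fin \<B> by (intro finite_subset[of \<B> "Pow E"]) auto
  with pos fin \<B> show ?thesis
    by (intro completely_monotoneI smooth_expr.powr smooth_expr_sum_prod) auto
qed

end

section \<open>Bases of matroids and unimodular representations\<close>

context matroid
begin

lemma indep_finite: "indep X \<Longrightarrow> finite X"
  using finite_ground indep_subset_ground finite_subset by blast

text \<open>A set of maximum size augments any smaller independent set, so maximality for inclusion
  and for size agree.\<close>

lemma bases_iff: "B \<in> bases E indep \<longleftrightarrow> indep B \<and> card B = matroid_rank E indep"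
proof -
  let ?C = "card ` {X. X \<subseteq> E \<and> indep X}"
  have fin: "finite ?C" using finite_ground by simp
  have le: "card X \<le> matroid_rank E indep" if "indep X" for X
    unfolding matroid_rank_def using that indep_subset_ground by (intro Max_ge[OF fin]) auto
  have "matroid_rank E indep \<in> ?C"
    unfolding matroid_rank_def by (rule Max_in[OF fin]) (use indep_empty in auto)
  then obtain Y where Y: "indep Y" "card Y = matroid_rank E indep" by auto
  show ?thesis
  proof
    assume B: "B \<in> bases E indep"
    have "\<not> card B < card Y"
    proof
      assume "card B < card Y"
      then obtain e where "e \<in> Y - B" "indep (insert e B)"
        using indep_augment[of B Y] B Y by (auto simp: bases_def)
      then show False using B indep_subset_ground[of "insert e B"] unfolding bases_def by blast
    qed
    then show "indep B \<and> card B = matroid_rank E indep"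
      using B Y le[of B] by (auto simp: bases_def)
  next
    assume B: "indep B \<and> card B = matroid_rank E indep"
    have "X = B" if "indep X" "B \<subseteq> X" for X
      using card_subset_eq[OF indep_finite[OF that(1)] that(2)] B le[OF that(1)] card_mono[OF indep_finite[OF that(1)] that(2)]
      by auto
    then show "B \<in> bases E indep"
      using B indep_subset_ground by (auto simp: bases_def)
  qed
qed

lemma bases_nonempty: "bases E indep \<noteq> {}"
proof -
  let ?C = "card ` {X. X \<subseteq> E \<and> indep X}"
  have "matroid_rank E indep \<in> ?C"
    unfolding matroid_rank_def by (rule Max_in) (use finite_ground indep_empty in auto)
  then show ?thesis using bases_iff by auto
qed

lemma bases_subset: "S \<in> bases E indep \<Longrightarrow> S \<subseteq> E \<and> card S = matroid_rank E indep"
  using bases_iff indep_subset_ground by blast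

end

text \<open>Determinant and independence are both compared with the rank. Repeated columns agree on
  the two sides: they lower the rank, and \<open>represents\<close> counts them as
  dependent.\<close>

lemma represents_det_iff:
  fixes B :: "'e \<Rightarrow> 'k::field vec"
  assumes rep: "represents r B E indep" and es: "distinct es" "set es \<subseteq> E" "length es = r"
  shows "Determinant.det (mat_of_cols r (map B es)) \<noteq> 0 \<longleftrightarrow> indep (set es)"
proof -
  interpret vec_space "TYPE('k)" r .
  let ?A = "mat_of_cols r (map B es)"
  have B: "set (map B es) \<subseteq> carrier_vec r" using rep es by (auto simp: represents_def)
  have A: "?A \<in> carrier_mat r r" using es by (simp add: carrier_matI)
  have cols: "cols ?A = map B es" using B by (rule cols_mat_of_cols)
  have iff: "indep (set es) \<longleftrightarrow> distinct (cols ?A) \<and> lin_indpt (set (cols ?A))"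
    using rep es unfolding cols by (auto simp: represents_def distinct_map)
  show ?thesis
  proof
    assume "Determinant.det ?A \<noteq> 0"
    then have "rank ?A = r" using det_rank_iff[OF A] by simp
    then show "indep (set es)"
      unfolding iff using non_distinct_low_rank[OF A] full_rank_lin_indpt[OF A] by auto
  next
    assume "indep (set es)"
    then have "rank ?A = r" unfolding iff using lin_indpt_full_rank[OF A] by blast
    then show "Determinant.det ?A \<noteq> 0" using det_rank_iff[OF A] by simp
  qed
qed

text \<open>Unimodularity leaves 0 and 1 as squared norms, and nonsingularity picks out the bases.
  The map \<open>f\<close> stands for the embedding of the field into the complex numbers; a
  transpose enters because the columns \<open>B e\<close> become rows.\<close>

lemma (in matroid) unimodular_minors:
  fixes B :: "'e \<Rightarrow> 'k::real_normed_field vec" and f :: "'k \<Rightarrow> complex"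
  assumes rep: "represents (matroid_rank E indep) B E indep" and uni: "unimodular (matroid_rank E indep) B E"
    and f: "comm_ring_hom f" and norm_f: "\<And>a. cmod (f a) = norm a"
    and es: "distinct es" "set es \<subseteq> E" "length es = matroid_rank E indep"
  shows "cmod (Determinant.det (mat (matroid_rank E indep) (matroid_rank E indep) (\<lambda>(i, j). f (B (es ! i) $ j)))) ^ 2 =
    (if set es \<in> bases E indep then 1 else 0)"
proof -
  interpret f: comm_ring_hom f by fact
  let ?r = "matroid_rank E indep"
  let ?A = "mat_of_cols ?r (map B es)"
  have A: "?A \<in> carrier_mat ?r ?r" using es by (simp add: carrier_matI)
  have "mat ?r ?r (\<lambda>(i, j). f (B (es ! i) $ j)) = map_mat f (transpose_mat ?A)"
    using es by (intro eq_matI) (auto simp: mat_of_cols_def)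
  then have "Determinant.det (mat ?r ?r (\<lambda>(i, j). f (B (es ! i) $ j))) = f (Determinant.det ?A)"
    using det_transpose[OF A] by simp
  then have *: "cmod (Determinant.det (mat ?r ?r (\<lambda>(i, j). f (B (es ! i) $ j)))) = norm (Determinant.det ?A)"
    by (simp add: norm_f)
  have "set es \<in> bases E indep \<longleftrightarrow> Determinant.det ?A \<noteq> 0"
    using represents_det_iff[OF rep es] bases_iff es by (auto simp: distinct_card)
  moreover have "(norm (Determinant.det ?A))\<^sup>2 \<in> {0, 1}" using uni es unfolding unimodular_def by blast
  ultimately show ?thesis unfolding * by auto
qed

theorem (in matroid) real_unimodular_completely_monotone:
  assumes "real_unimodular E indep" and \<beta>: "\<beta> \<in> real_exponents (matroid_rank E indep)"
  shows "completely_monotone E (\<lambda>x. basis_poly E indep x powr - \<beta>)"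
proof -
  let ?r = "matroid_rank E indep"
  obtain B :: "'e \<Rightarrow> real vec" where B: "represents ?r B E indep" "unimodular ?r B E"
    using assms(1) unfolding real_unimodular_def by blast
  interpret gaussian_field \<real> lborel "\<lambda>t::real. complex_of_real (sqrt pi * t)" "1 / 2"
    by (rule gaussian_field_real)
  show ?thesis
    unfolding basis_poly_def
  proof (rule completely_monotone_basis_sum[where r = ?r and v = "\<lambda>e i. complex_of_real (B e $ i)"])
    show "(\<exists>m::nat. \<beta> = real m * (1 / 2)) \<or> \<beta> \<ge> (real ?r - 1) * (1 / 2)"
      using \<beta> by (auto simp: real_exponents_def)
    show "cmod (Determinant.det (mat ?r ?r (\<lambda>(i, j). complex_of_real (B (es ! i) $ j)))) ^ 2 =
        (if set es \<in> bases E indep then 1 else 0)"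
      if "distinct es" "set es \<subseteq> E" "length es = ?r" for es
      by (rule unimodular_minors[OF B _ _ that]) (auto intro: of_real_hom.comm_ring_hom_axioms)
  qed (use finite_ground bases_subset bases_nonempty in auto)
qed

theorem (in matroid) complex_unimodular_completely_monotone:
  assumes "complex_unimodular E indep" and \<beta>: "\<beta> \<in> complex_exponents (matroid_rank E indep)"
  shows "completely_monotone E (\<lambda>x. basis_poly E indep x powr - \<beta>)"
proof -
  let ?r = "matroid_rank E indep"
  obtain B :: "'e \<Rightarrow> complex vec" where B: "represents ?r B E indep" "unimodular ?r B E"
    using assms(1) unfolding complex_unimodular_def by blast
  interpret gaussian_field UNIV "lborel \<Otimes>\<^sub>M lborel"
    "\<lambda>t::real \<times> real. Complex (sqrt pi * fst t) (sqrt pi * snd t)" 1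
    by (rule gaussian_field_complex)
  show ?thesis
    unfolding basis_poly_def
  proof (rule completely_monotone_basis_sum[where r = ?r and v = "\<lambda>e i. B e $ i"])
    show "(\<exists>m::nat. \<beta> = real m * 1) \<or> \<beta> \<ge> (real ?r - 1) * 1"
      using \<beta> by (auto simp: complex_exponents_def)
    show "cmod (Determinant.det (mat ?r ?r (\<lambda>(i, j). B (es ! i) $ j))) ^ 2 =
        (if set es \<in> bases E indep then 1 else 0)"
      if "distinct es" "set es \<subseteq> E" "length es = ?r" for es
      by (rule unimodular_minors[OF B _ _ that]) (auto simp: comm_ring_hom_def, unfold_locales, auto)
  qed (use finite_ground bases_subset bases_nonempty in auto)
qed

section \<open>Duality\<close>

text \<open>Sylvester's identity. The block matrix with rows (I, P) and (-Q, I) factors both as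
  \<open>?L * ?U\<close> and as \<open>?V * ?L\<close>, and \<open>?L\<close> has determinant
  1.\<close>

lemma det_one_plus_mult_commute:
  fixes P :: "'k::idom mat"
  assumes P: "P \<in> carrier_mat r m" and Q: "Q \<in> carrier_mat m r"
  shows "Determinant.det (1\<^sub>m r + P * Q) = Determinant.det (1\<^sub>m m + Q * P)"
proof -
  let ?L = "four_block_mat (1\<^sub>m r) (0\<^sub>m r m) (- Q) (1\<^sub>m m)"
  let ?U = "four_block_mat (1\<^sub>m r) P (0\<^sub>m m r) (1\<^sub>m m + Q * P)"
  let ?V = "four_block_mat (1\<^sub>m r + P * Q) P (0\<^sub>m m r) (1\<^sub>m m)"
  have carr: "?L \<in> carrier_mat (r + m) (r + m)" "?U \<in> carrier_mat (r + m) (r + m)"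
    "?V \<in> carrier_mat (r + m) (r + m)"
    using P Q by auto
  have PQ: "P * Q \<in> carrier_mat r r" and QP: "Q * P \<in> carrier_mat m m" using P Q by auto
  have "?L * ?U = four_block_mat (1\<^sub>m r) P (- Q) (1\<^sub>m m)"
  proof -
    have "?L * ?U = four_block_mat (1\<^sub>m r * 1\<^sub>m r + 0\<^sub>m r m * 0\<^sub>m m r) (1\<^sub>m r * P + 0\<^sub>m r m * (1\<^sub>m m + Q * P))
      (- Q * 1\<^sub>m r + 1\<^sub>m m * 0\<^sub>m m r) (- Q * P + 1\<^sub>m m * (1\<^sub>m m + Q * P))"
      by (rule mult_four_block_mat) (use P Q QP in auto)
    moreover have "- Q * P + (1\<^sub>m m + Q * P) = 1\<^sub>m m"
      using P Q QP by (intro eq_matI) auto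
    ultimately show ?thesis using P Q QP by simp
  qed
  moreover have "?V * ?L = four_block_mat (1\<^sub>m r) P (- Q) (1\<^sub>m m)"
  proof -
    have "?V * ?L = four_block_mat ((1\<^sub>m r + P * Q) * 1\<^sub>m r + P * (- Q)) ((1\<^sub>m r + P * Q) * 0\<^sub>m r m + P * 1\<^sub>m m)
      (0\<^sub>m m r * 1\<^sub>m r + 1\<^sub>m m * (- Q)) (0\<^sub>m m r * 0\<^sub>m r m + 1\<^sub>m m * 1\<^sub>m m)"
      by (rule mult_four_block_mat) (use P Q PQ in auto)
    moreover have "(1\<^sub>m r + P * Q) + P * (- Q) = 1\<^sub>m r"
      using P Q PQ by (intro eq_matI) auto
    ultimately show ?thesis using P Q PQ by simp
  qed
  ultimately have "Determinant.det ?L * Determinant.det ?U = Determinant.det ?V * Determinant.det ?L"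
    using det_mult[OF carr(1,2)] det_mult[OF carr(3,1)] by simp
  moreover have "Determinant.det ?L = 1"
    by (subst det_four_block_mat_upper_right_zero) (use Q in auto)
  moreover have "Determinant.det ?U = Determinant.det (1\<^sub>m m + Q * P)"
    by (subst det_four_block_mat_lower_left_zero) (use P QP in auto)
  moreover have "Determinant.det ?V = Determinant.det (1\<^sub>m r + P * Q)"
    by (subst det_four_block_mat_lower_left_zero) (use P PQ in auto)
  ultimately show ?thesis by simp
qed

lemma det_scale_rows:
  fixes a :: "nat \<Rightarrow> nat \<Rightarrow> 'k::comm_ring_1"
  shows "Determinant.det (mat r r (\<lambda>(i, j). c i * a i j)) = (\<Prod>i<r. c i) * Determinant.det (mat r r (\<lambda>(i, j). a i j))"
proof -
  have "Determinant.det (mat r r (\<lambda>(i, j). c i * a i j)) =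
      (\<Sum>\<sigma> | \<sigma> permutes {0..<r}. signof \<sigma> * (\<Prod>i = 0..<r. c i * a i (\<sigma> i)))"
    by (subst det_def'[of _ r]) (auto intro!: sum.cong prod.cong simp: permutes_less)
  also have "\<dots> = (\<Prod>i<r. c i) * (\<Sum>\<sigma> | \<sigma> permutes {0..<r}. signof \<sigma> * (\<Prod>i = 0..<r. a i (\<sigma> i)))"
    by (simp add: prod.distrib sum_distrib_left lessThan_atLeast0 mult_ac)
  also have "(\<Sum>\<sigma> | \<sigma> permutes {0..<r}. signof \<sigma> * (\<Prod>i = 0..<r. a i (\<sigma> i))) =
      Determinant.det (mat r r (\<lambda>(i, j). a i j))"
    by (subst det_def'[of _ r]) (auto intro!: sum.cong prod.cong simp: permutes_less)
  finally show ?thesis .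
qed

text \<open>This is the passage from a representation \<open>[I | A]\<close> to \<open>[A\<^sup>* | I]\<close>, where \<open>x\<close> and \<open>z\<close> are the
  variables of the two blocks; it avoids comparing complementary minors.\<close>

lemma det_dual:
  fixes a :: "nat \<Rightarrow> nat \<Rightarrow> 'k::field"
  assumes x: "\<And>i. i < r \<Longrightarrow> x i \<noteq> 0" and z: "\<And>j. j < m \<Longrightarrow> z j \<noteq> 0"
  shows "Determinant.det (mat m m (\<lambda>(j, k). (if j = k then z j else 0) + (\<Sum>i<r. x i * a' j i * a i k))) =
    (\<Prod>i<r. x i) * (\<Prod>j<m. z j) *
    Determinant.det (mat r r (\<lambda>(i, l). (if i = l then 1 / x i else 0) + (\<Sum>j<m. (1 / z j) * a i j * a' j l)))"
proof -
  \<comment> \<open>\<open>P\<close> absorbs the x_i and \<open>Q\<close> the reciprocals of the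
    z_j, so that the two matrices are row scalings, by z and by x, of I + Q P and I + P Q.\<close>
  define P where "P = mat r m (\<lambda>(i, j). x i * a i j)"
  define Q where "Q = mat m r (\<lambda>(j, i). a' j i / z j)"
  have P: "P \<in> carrier_mat r m" and Q: "Q \<in> carrier_mat m r" by (auto simp: P_def Q_def)
  have "mat m m (\<lambda>(j, k). (if j = k then z j else 0) + (\<Sum>i<r. x i * a' j i * a i k)) =
      mat m m (\<lambda>(j, k). z j * (1\<^sub>m m + Q * P) $$ (j, k))"
    by (rule eq_matI)
      (auto simp: P_def Q_def scalar_prod_def lessThan_atLeast0 sum_distrib_left z distrib_left intro!: sum.cong)
  moreover have "1\<^sub>m m + Q * P = mat m m (\<lambda>(j, k). (1\<^sub>m m + Q * P) $$ (j, k))"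
    using P Q by (intro eq_matI) auto
  ultimately have 1: "Determinant.det (mat m m (\<lambda>(j, k). (if j = k then z j else 0) + (\<Sum>i<r. x i * a' j i * a i k))) =
      (\<Prod>j<m. z j) * Determinant.det (1\<^sub>m m + Q * P)"
    by (simp only: det_scale_rows)
  let ?G = "\<lambda>i l. (if i = l then 1 / x i else 0) + (\<Sum>j<m. (1 / z j) * a i j * a' j l)"
  have "1\<^sub>m r + P * Q = mat r r (\<lambda>(i, l). x i * ?G i l)"
    by (rule eq_matI)
      (auto simp: P_def Q_def scalar_prod_def lessThan_atLeast0 sum_distrib_left x distrib_left intro!: sum.cong)
  then have "Determinant.det (1\<^sub>m r + P * Q) = (\<Prod>i<r. x i) * Determinant.det (mat r r (\<lambda>(i, l). ?G i l))"
    by (simp only: det_scale_rows)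
  with 1 show ?thesis
    using det_one_plus_mult_commute[OF P Q] by (simp add: mult_ac)
qed

text \<open>The sum at x is the product of all x_e times the basis sum at the reciprocals 1/x_e. The
  latter is a Gram determinant of order r in which \<open>unit\<close> makes the contribution of
  \<open>b\<close> diagonal, and \<open>det_dual\<close> converts it into a Gram determinant of
  order card E - r.\<close>

lemma (in gaussian_field) completely_monotone_cobasis_sum:
  fixes v :: "'e \<Rightarrow> nat \<Rightarrow> complex"
  assumes fin: "finite E" and \<B>: "\<And>S. S \<in> \<B> \<Longrightarrow> S \<subseteq> E \<and> card S = r"
    and vF: "\<And>e i. e \<in> E \<Longrightarrow> i < r \<Longrightarrow> v e i \<in> F"
    and minor: "\<And>es. distinct es \<Longrightarrow> set es \<subseteq> E \<Longrightarrow> length es = r \<Longrightarrow>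
      cmod (Determinant.det (mat r r (\<lambda>(i, j). v (es ! i) j))) ^ 2 = (if set es \<in> \<B> then 1 else 0)"
    and b: "distinct b" "set b \<subseteq> E" "length b = r"
    and unit: "\<And>i j. i < r \<Longrightarrow> j < r \<Longrightarrow> v (b ! i) j = (if i = j then 1 else 0)"
    and \<beta>: "(\<exists>k::nat. \<beta> = real k * \<delta>) \<or> \<beta> \<ge> (real (card E - r) - 1) * \<delta>" and \<delta>: "\<delta> \<ge> 0"
  shows "completely_monotone E (\<lambda>x. (\<Sum>S\<in>\<B>. \<Prod>e\<in>E - S. x e) powr - \<beta>)"
proof -
  obtain c where c: "distinct c" "set c = E - set b"
    using finite_distinct_list[of "E - set b"] fin by auto
  define m where "m = length c"
  have m: "m = card E - r"
    using distinct_card[OF c(1)] distinct_card[OF b(1)] c(2) b fin by (simp add: m_def card_Diff_subset)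
  have E: "E = set b \<union> set c" "set b \<inter> set c = {}" using b(2) c(2) by auto
  \<comment> \<open>Dual vectors: on \<open>c\<close> they are unit vectors, and on \<open>b\<close>
    they form the conjugate transpose of the block of \<open>v\<close> on \<open>c\<close>.
    \<open>THE\<close> recovers the position of an element in \<open>b\<close>.\<close>
  define w where "w e j = (if e \<in> set c then if e = c ! j then 1 else 0
      else cnj (v (c ! j) (THE i. i < r \<and> b ! i = e)))" for e j
  have w_c: "w (c ! i) j = (if i = j then 1 else 0)" if "i < m" "j < m" for i j
    using that c(1) by (simp add: w_def m_def nth_eq_iff_index_eq)
  have w_b: "w (b ! i) j = cnj (v (c ! j) i)" if "i < r" for i j
  proof -
    have "b ! i \<notin> set c" using E(2) that b(3) nth_mem[of i b] by blast
    moreover have "(THE k. k < r \<and> b ! k = b ! i) = i"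
      using that b by (intro the_equality) (auto simp: nth_eq_iff_index_eq)
    ultimately show ?thesis by (simp add: w_def)
  qed
  have sum_E: "(\<Sum>e\<in>E. f e) = (\<Sum>i<r. f (b ! i)) + (\<Sum>j<m. f (c ! j))" for f :: "'e \<Rightarrow> complex"
  proof -
    have "(\<Sum>e\<in>E. f e) = (\<Sum>e\<in>set b. f e) + (\<Sum>e\<in>set c. f e)"
      unfolding E(1) by (rule sum.union_disjoint) (use E(2) in auto)
    then show ?thesis
      using sum.reindex_bij_betw[OF bij_betw_nth[OF b(1) refl refl], of f]
        sum.reindex_bij_betw[OF bij_betw_nth[OF c(1) refl refl], of f] b(3) by (simp add: m_def)
  qed
  have prod_E: "(\<Prod>e\<in>E. f e) = (\<Prod>i<r. f (b ! i)) * (\<Prod>j<m. f (c ! j))" for f :: "'e \<Rightarrow> complex"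
  proof -
    have "(\<Prod>e\<in>E. f e) = (\<Prod>e\<in>set b. f e) * (\<Prod>e\<in>set c. f e)"
      unfolding E(1) by (rule prod.union_disjoint) (use E(2) in auto)
    then show ?thesis
      using prod.reindex_bij_betw[OF bij_betw_nth[OF b(1) refl refl], of f]
        prod.reindex_bij_betw[OF bij_betw_nth[OF c(1) refl refl], of f] b(3) by (simp add: m_def)
  qed
  have gram: "complex_of_real (\<Sum>S\<in>\<B>. \<Prod>e\<in>E - S. x e) =
      Determinant.det (mat m m (\<lambda>(i, j). \<Sum>e\<in>E. of_real (x e) * cnj (w e i) * w e j))"
    if x: "x \<in> pos_orthant E" for x
  proof -
    have "x e > 0" if "e \<in> E" for e using x that by auto
    then have x0: "x e \<noteq> 0" if "e \<in> E" for e using that by fastforce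
    have xb: "x (b ! i) \<noteq> 0" if "i < r" for i
      by (rule x0) (use b that nth_mem[of i b] in auto)
    have xc: "x (c ! j) \<noteq> 0" if "j < m" for j
      by (rule x0) (use c that nth_mem[of j c] in \<open>auto simp: m_def\<close>)
    have "(\<Prod>e\<in>E - S. x e) = (\<Prod>e\<in>E. x e) * (\<Prod>e\<in>S. 1 / x e)" if "S \<in> \<B>" for S
    proof -
      have "S \<subseteq> E" using \<B> that by blast
      then have "(\<Prod>e\<in>E. x e) = (\<Prod>e\<in>E - S. x e) * (\<Prod>e\<in>S. x e)"
        by (rule prod.subset_diff[OF _ fin])
      moreover have "(\<Prod>e\<in>S. x e) * (\<Prod>e\<in>S. 1 / x e) = 1"
        unfolding prod.distrib[symmetric] using x0 \<open>S \<subseteq> E\<close> by (intro prod.neutral) auto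
      ultimately show ?thesis by (simp add: mult.assoc)
    qed
    then have "complex_of_real (\<Sum>S\<in>\<B>. \<Prod>e\<in>E - S. x e) =
        (\<Prod>e\<in>E. of_real (x e)) * of_real (\<Sum>S\<in>\<B>. \<Prod>e\<in>S. 1 / x e)"
      by (simp add: sum_distrib_left)
    also have "complex_of_real (\<Sum>S\<in>\<B>. \<Prod>e\<in>S. 1 / x e) =
        Determinant.det (mat r r (\<lambda>(i, j). \<Sum>e\<in>E. of_real (1 / x e) * cnj (v e i) * v e j))"
      by (rule basis_sum_eq_det[OF fin \<B> minor])
    also have "mat r r (\<lambda>(i, j). \<Sum>e\<in>E. of_real (1 / x e) * cnj (v e i) * v e j) =
        mat r r (\<lambda>(i, l). (if i = l then 1 / complex_of_real (x (b ! i)) else 0) +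
          (\<Sum>j<m. (1 / complex_of_real (x (c ! j))) * cnj (v (c ! j) i) * v (c ! j) l))"
      by (rule eq_matI) (auto simp: sum_E unit if_distrib if_distribR cong: if_cong)
    also have "(\<Prod>e\<in>E. complex_of_real (x e)) * Determinant.det \<dots> =
        Determinant.det (mat m m (\<lambda>(j, k). (if j = k then complex_of_real (x (c ! j)) else 0) +
          (\<Sum>i<r. complex_of_real (x (b ! i)) * v (c ! j) i * cnj (v (c ! k) i))))"
      unfolding prod_E
      by (rule det_dual[symmetric, where a = "\<lambda>i j. cnj (v (c ! j) i)" and a' = "\<lambda>j i. v (c ! j) i"])
        (use xb xc in auto)
    also have "mat m m (\<lambda>(j, k). (if j = k then complex_of_real (x (c ! j)) else 0) +
          (\<Sum>i<r. complex_of_real (x (b ! i)) * v (c ! j) i * cnj (v (c ! k) i))) =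
        mat m m (\<lambda>(i, j). \<Sum>e\<in>E. of_real (x e) * cnj (w e i) * w e j)"
      by (rule eq_matI) (auto simp: sum_E w_b w_c if_distrib if_distribR cong: if_cong)
    finally show ?thesis .
  qed
  have wF: "w e i \<in> F" if "e \<in> E" "i < m" for e i
  proof (cases "e \<in> set c")
    case True
    then show ?thesis by (simp add: w_def F_zero F_one)
  next
    case False
    then have "e \<in> set b" using that(1) E(1) by blast
    then obtain k where k: "k < r" "e = b ! k" using b(3) by (auto simp: in_set_conv_nth)
    have "c ! i \<in> E" using that(2) c(2) nth_mem[of i c] by (auto simp: m_def)
    then show ?thesis unfolding k(2) w_b[OF k(1)] by (intro F_cnj vF k(1))
  qed
  \<comment> \<open>The unit vectors attached to \<open>c\<close> already span.\<close>
  have span: "y i = 0" if 0: "\<And>e. e \<in> E \<Longrightarrow> (\<Sum>i<m. w e i * y i) = 0" and i: "i < m" for y i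
  proof -
    have "c ! i \<in> E" using i c(2) nth_mem[of i c] by (auto simp: m_def)
    from 0[OF this] show ?thesis using i by (simp add: w_c if_distrib if_distribR cong: if_cong)
  qed
  have pos: "(\<forall>x\<in>pos_orthant E. (\<Sum>S\<in>\<B>. \<Prod>e\<in>E - S. x e) > 0) \<and>
      diff_monotone n E (\<lambda>x. (\<Sum>S\<in>\<B>. \<Prod>e\<in>E - S. x e) powr - \<beta>)" for n
  proof (rule det_diff_monotone[where N = m and v = w])
    show "(\<exists>k::nat. \<beta> = real k * \<delta>) \<or> (real m - 1) * \<delta> \<le> \<beta>" unfolding m by (rule \<beta>)
  qed (fact fin \<delta> | rule wF gram; assumption | erule span, assumption)+
  have "finite \<B>" using fin \<B> by (intro finite_subset[of \<B> "Pow E"]) auto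
  with pos fin show ?thesis
    by (intro completely_monotoneI smooth_expr.powr smooth_expr_sum_prod) auto
qed

section \<open>Graphic matroids\<close>

text \<open>\<open>is_cycle\<close> asks for distinct vertices, whereas reachability only gives a
  walk.\<close>

lemma simple_path:
  assumes "(a, b) \<in> R\<^sup>*"
  shows "\<exists>vs. vs \<noteq> [] \<and> hd vs = a \<and> last vs = b \<and> distinct vs \<and>
    (\<forall>i. Suc i < length vs \<longrightarrow> (vs ! i, vs ! Suc i) \<in> R)"
  using assms
proof (induction rule: rtrancl_induct)
  case base
  show ?case by (rule exI[of _ "[a]"]) simp
next
  case (step y z)
  then obtain vs where vs: "vs \<noteq> []" "hd vs = a" "last vs = y" "distinct vs"
    "\<And>i. Suc i < length vs \<Longrightarrow> (vs ! i, vs ! Suc i) \<in> R"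
    by blast
  show ?case
  proof (cases "z \<in> set vs")
    \<comment> \<open>When z was visited before, the path is cut back to that visit.\<close>
    case True
    then obtain k where k: "k < length vs" "vs ! k = z" by (auto simp: in_set_conv_nth)
    show ?thesis
    proof (intro exI[of _ "take (Suc k) vs"] conjI allI impI)
      show "take (Suc k) vs \<noteq> []" "hd (take (Suc k) vs) = a" "distinct (take (Suc k) vs)"
        using vs by auto
      show "last (take (Suc k) vs) = z" using k by (simp add: take_Suc_conv_app_nth)
      fix i assume "Suc i < length (take (Suc k) vs)"
      then show "(take (Suc k) vs ! i, take (Suc k) vs ! Suc i) \<in> R" using vs(5)[of i] by simp
    qed
  next
    case False
    show ?thesis
    proof (intro exI[of _ "vs @ [z]"] conjI allI impI)
      show "vs @ [z] \<noteq> []" "hd (vs @ [z]) = a" "distinct (vs @ [z])" "last (vs @ [z]) = z"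
        using vs False by auto
      fix i assume i: "Suc i < length (vs @ [z])"
      show "((vs @ [z]) ! i, (vs @ [z]) ! Suc i) \<in> R"
      proof (cases "Suc i < length vs")
        case True
        then show ?thesis using vs(5)[of i] by (simp add: nth_append)
      next
        case False
        then have i: "i = length vs - 1" "Suc i = length vs" "i < length vs" using i vs(1) by auto
        then have "vs ! i = y" using vs(1,3) last_conv_nth[of vs] by simp
        then show ?thesis using i step.hyps(2) by (simp add: nth_append)
      qed
    qed
  qed
qed

text \<open>There is one more vector than coordinates. An added zero row makes the matrix square and
  singular, and a singular matrix over an integral domain has a kernel vector over the same
  domain.\<close>

lemma int_dependent:
  fixes a :: "nat \<Rightarrow> nat \<Rightarrow> int"
  shows "\<exists>c. (\<exists>i<Suc m. c i \<noteq> 0) \<and> (\<forall>k<m. (\<Sum>i<Suc m. c i * a i k) = 0)"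
proof -
  let ?M = "mat (Suc m) (Suc m) (\<lambda>(k, i). if k < m then a i k else 0)"
  have "Determinant.det ?M = 0"
    by (subst det_def'[of _ "Suc m"]) (auto intro!: sum.neutral prod_zero bexI[of _ m] simp: permutes_less)
  moreover have "?M \<in> carrier_mat (Suc m) (Suc m)" by simp
  ultimately obtain v where v: "v \<in> carrier_vec (Suc m)" "v \<noteq> 0\<^sub>v (Suc m)" "?M *\<^sub>v v = 0\<^sub>v (Suc m)"
    using det_0_iff_vec_prod_zero by blast
  have "\<exists>i<Suc m. v $ i \<noteq> 0"
  proof (rule ccontr)
    assume "\<not> ?thesis"
    then have "v = 0\<^sub>v (Suc m)" using v(1) by (intro eq_vecI) auto
    with v(2) show False by simp
  qed
  moreover have "(\<Sum>i<Suc m. v $ i * a i k) = 0" if k: "k < m" for k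
  proof -
    have "(?M *\<^sub>v v) $ k = (\<Sum>i<Suc m. v $ i * a i k)"
      using k v(1) by (simp add: scalar_prod_def lessThan_atLeast0 mult.commute)
    then show ?thesis using k by (simp add: v(3))
  qed
  ultimately show ?thesis by blast
qed

section \<open>Forests and incidence vectors\<close>

context multigraph
begin

abbreviation conn :: "'e set \<Rightarrow> ('v \<times> 'v) set" where
  "conn F \<equiv> (adjacent_via ends F)\<^sup>*"

text \<open>An arbitrary orientation. A loop gets equal source and target, hence the zero incidence
  vector.\<close>

definition src :: "'e \<Rightarrow> 'v" where "src e = (SOME a. \<exists>b. ends e = {a, b})"
definition tgt :: "'e \<Rightarrow> 'v" where "tgt e = (SOME b. ends e = {src e, b})"
definition incidence :: "'e \<Rightarrow> 'v \<Rightarrow> int" where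
  "incidence e u = of_bool (u = tgt e) - of_bool (u = src e)"
text \<open>Acyclicity in terms of bridges. The component left behind by a bridge is the cut on
  which incidence vectors are tested; agreement with the absence of cycles is
  \<open>graphic_indep_iff_forest\<close>.\<close>

definition forest :: "'e set \<Rightarrow> bool" where
  "forest F \<longleftrightarrow> F \<subseteq> E \<and> (\<forall>e\<in>F. (src e, tgt e) \<notin> conn (F - {e}))"

lemma ends_eq: "e \<in> E \<Longrightarrow> ends e = {src e, tgt e}"
proof -
  assume e: "e \<in> E"
  have "\<exists>a b. ends e = {a, b}"
  proof (cases "card (ends e) = 1")
    case True
    then obtain a where "ends e = {a}" by (rule card_1_singletonE)
    then show ?thesis by (intro exI[of _ a]) simp
  next
    case False
    then have "card (ends e) = 2" using card_ends[OF e] by simp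
    then show ?thesis by (auto simp: card_2_iff)
  qed
  then have "\<exists>b. ends e = {src e, b}" unfolding src_def by (rule someI_ex)
  then show "ends e = {src e, tgt e}" unfolding tgt_def by (rule someI_ex)
qed

lemma src_tgt_in_verts: "e \<in> E \<Longrightarrow> src e \<in> V" "e \<in> E \<Longrightarrow> tgt e \<in> V"
  using ends_eq ends_in_verts by blast+

lemma conn_sym: "(a, b) \<in> conn F \<Longrightarrow> (b, a) \<in> conn F"
proof -
  have "sym (adjacent_via ends F)" by (auto simp: sym_def adjacent_via_def insert_commute)
  then show "(a, b) \<in> conn F \<Longrightarrow> (b, a) \<in> conn F" using sym_rtrancl symD by fastforce
qed

lemma conn_mono: "F \<subseteq> G \<Longrightarrow> (a, b) \<in> conn F \<Longrightarrow> (a, b) \<in> conn G"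
  using rtrancl_mono[of "adjacent_via ends F" "adjacent_via ends G"] by (auto simp: adjacent_via_def)

lemma adjacent_edge: "f \<in> F \<Longrightarrow> f \<in> E \<Longrightarrow> (src f, tgt f) \<in> conn F"
  using ends_eq[of f] by (intro r_into_rtrancl) (auto simp: adjacent_via_def)

lemma cycle_imp_conn:
  assumes F: "F \<subseteq> E" and cyc: "is_cycle ends vs es" "set es \<subseteq> F"
  shows "\<exists>e\<in>F. (src e, tgt e) \<in> conn (F - {e})"
proof -
  let ?n = "length es"
  have n: "?n > 0" "length vs = ?n" and dist: "distinct es"
    and ends: "\<And>i. i < ?n \<Longrightarrow> ends (es ! i) = {vs ! i, vs ! (Suc i mod ?n)}"
    using cyc(1) by (auto simp: is_cycle_def)
  \<comment> \<open>The last edge is the one removed, because the remaining path from vertex 0 then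
    has no index that wraps around.\<close>
  define e where "e = es ! (?n - 1)"
  have e: "e \<in> F" using cyc(2) n nth_mem[of "?n - 1" es] by (auto simp: e_def)
  have path: "(vs ! 0, vs ! i) \<in> conn (F - {e})" if "i < ?n" for i
    using that
  proof (induction i)
    case (Suc i)
    have "es ! i \<in> F" using cyc(2) Suc.prems nth_mem[of i es] by auto
    moreover have "es ! i \<noteq> e"
      using dist Suc.prems n unfolding e_def by (subst nth_eq_iff_index_eq) auto
    moreover have "ends (es ! i) = {vs ! i, vs ! Suc i}" using ends[of i] Suc.prems by simp
    ultimately have "(vs ! i, vs ! Suc i) \<in> adjacent_via ends (F - {e})" by (auto simp: adjacent_via_def)
    with Suc show ?case by (auto intro: rtrancl_into_rtrancl)
  qed simp
  have "ends e = {vs ! (?n - 1), vs ! 0}" using ends[of "?n - 1"] n by (simp add: e_def)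
  then have "{src e, tgt e} = {vs ! (?n - 1), vs ! 0}" using ends_eq[of e] e F by auto
  then have "(src e, tgt e) = (vs ! 0, vs ! (?n - 1)) \<or> (src e, tgt e) = (vs ! (?n - 1), vs ! 0)"
    by (auto simp: doubleton_eq_iff)
  moreover have "(vs ! 0, vs ! (?n - 1)) \<in> conn (F - {e})" using path[of "?n - 1"] n by simp
  ultimately have "(src e, tgt e) \<in> conn (F - {e})" using conn_sym by auto
  with e show ?thesis by blast
qed

text \<open>A simple path from \<open>src e\<close> to \<open>tgt e\<close> avoiding e is closed up
  by e. For a loop this path is a single vertex and the cycle has length 1.\<close>

lemma conn_imp_cycle:
  assumes F: "F \<subseteq> E" and e: "e \<in> F" and conn: "(src e, tgt e) \<in> conn (F - {e})"
  shows "\<exists>vs es. is_cycle ends vs es \<and> set es \<subseteq> F"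
proof -
  obtain vs where vs: "vs \<noteq> []" "hd vs = src e" "last vs = tgt e" "distinct vs"
    "\<And>i. Suc i < length vs \<Longrightarrow> (vs ! i, vs ! Suc i) \<in> adjacent_via ends (F - {e})"
    using simple_path[OF conn] by blast
  define n where "n = length vs - 1"
  have n: "length vs = Suc n" using vs(1) by (simp add: n_def)
  define g where "g i = (SOME f. f \<in> F - {e} \<and> ends f = {vs ! i, vs ! Suc i})" for i
  have g: "g i \<in> F - {e} \<and> ends (g i) = {vs ! i, vs ! Suc i}" if "i < n" for i
  proof -
    have "\<exists>f. f \<in> F - {e} \<and> ends f = {vs ! i, vs ! Suc i}"
      using vs(5)[of i] that n by (auto simp: adjacent_via_def)
    then show ?thesis unfolding g_def by (rule someI_ex)
  qed
  define es where "es = map g [0..<n] @ [e]"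
  have len: "length es = Suc n" by (simp add: es_def)
  have es_nth: "es ! i = g i" if "i < n" for i using that by (simp add: es_def nth_append)
  have es_last: "es ! n = e" by (simp add: es_def nth_append)
  \<comment> \<open>An edge used twice would have the same pair of ends at two positions, which
    distinct vertices exclude.\<close>
  have "inj_on g {0..<n}"
  proof (rule inj_onI)
    fix i j assume ij: "i \<in> {0..<n}" "j \<in> {0..<n}" "g i = g j"
    then have "{vs ! i, vs ! Suc i} = {vs ! j, vs ! Suc j}" using g[of i] g[of j] by auto
    then show "i = j"
      using ij vs(4) n by (auto simp: doubleton_eq_iff nth_eq_iff_index_eq)
  qed
  moreover have "e \<notin> g ` {0..<n}"
  proof
    assume "e \<in> g ` {0..<n}"
    then obtain i where "i < n" "e = g i" by auto
    then show False using g[of i] by simp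
  qed
  ultimately have "distinct es" by (simp add: es_def distinct_map)
  moreover have "ends (es ! i) = {vs ! i, vs ! (Suc i mod length es)}" if "i < length es" for i
  proof (cases "i < n")
    case True
    then show ?thesis using g[of i] len by (simp add: es_nth)
  next
    case False
    then have i: "i = n" using that len by simp
    have "vs ! n = tgt e" using vs(1,3) n last_conv_nth[of vs] by simp
    moreover have "vs ! 0 = src e" using vs(1,2) hd_conv_nth[of vs] by simp
    ultimately show ?thesis
      using ends_eq[of e] e F len by (auto simp: i es_last)
  qed
  moreover have "set es \<subseteq> F" using g e by (auto simp: es_def)
  ultimately have "is_cycle ends vs es \<and> set es \<subseteq> F"
    using vs(4) n len unfolding is_cycle_def by (auto simp: es_def)
  then show ?thesis by blast
qed

lemma graphic_indep_iff_forest: "graphic_indep E ends F \<longleftrightarrow> forest F"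
proof
  assume "graphic_indep E ends F"
  then have F: "F \<subseteq> E" and acyclic: "\<not> (\<exists>vs es. is_cycle ends vs es \<and> set es \<subseteq> F)"
    unfolding graphic_indep_def by (rule conjunct1, rule conjunct2)
  have "(src e, tgt e) \<notin> conn (F - {e})" if "e \<in> F" for e
    using conn_imp_cycle[OF F that] acyclic by argo
  with F show "forest F" by (simp add: forest_def)
next
  assume "forest F"
  then have F: "F \<subseteq> E" and sep: "\<And>e. e \<in> F \<Longrightarrow> (src e, tgt e) \<notin> conn (F - {e})"
    by (simp_all add: forest_def)
  have False if cyc: "is_cycle ends vs es" "set es \<subseteq> F" for vs es
    using cycle_imp_conn[OF F cyc] sep by auto
  with F show "graphic_indep E ends F" by (auto simp: graphic_indep_def)
qed

text \<open>Incidence vectors along a path, with signs according to orientation, telescope to the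
  difference of its two ends.\<close>

lemma incidence_telescope:
  assumes F: "F \<subseteq> E" and "(a, b) \<in> conn F"
  shows "\<exists>c. \<forall>u. of_bool (u = b) - of_bool (u = a) = (\<Sum>f\<in>F. c f * incidence f u)"
  using assms(2)
proof (induction rule: rtrancl_induct)
  case base
  show ?case by (rule exI[of _ "\<lambda>f. 0"]) simp
next
  case (step y z)
  then obtain c where c: "\<And>u. of_bool (u = y) - of_bool (u = a) = (\<Sum>f\<in>F. c f * incidence f u)"
    by blast
  obtain f where f: "f \<in> F" "ends f = {y, z}" using step.hyps(2) by (auto simp: adjacent_via_def)
  then have "{src f, tgt f} = {y, z}" using ends_eq[of f] F by auto
  then have "(\<forall>u. of_bool (u = z) - of_bool (u = y) = incidence f u) \<or>
      (\<forall>u. of_bool (u = z) - of_bool (u = y) = - incidence f u)"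
    by (auto simp: doubleton_eq_iff incidence_def)
  then obtain s where s: "\<And>u. of_bool (u = z) - of_bool (u = y) = s * incidence f u"
    by (metis mult_1 mult_minus1)
  have fin: "finite F" using F finite_edges by (rule finite_subset)
  have "of_bool (u = z) - of_bool (u = a) = (\<Sum>g\<in>F. (c g + (if g = f then s else 0)) * incidence g u)" for u
  proof -
    have "(\<Sum>g\<in>F. (c g + (if g = f then s else 0)) * incidence g u) =
        (\<Sum>g\<in>F. c g * incidence g u + (if g = f then s * incidence f u else 0))"
      by (rule sum.cong) (auto simp: distrib_right)
    also have "\<dots> = (\<Sum>g\<in>F. c g * incidence g u) + s * incidence f u"
      using fin f(1) by (simp add: sum.distrib)
    finally show ?thesis using c[of u] s[of u] by simp
  qed
  then show ?case by (intro exI allI)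
qed

text \<open>Summing incidence vectors over a connected component is the linear functional that detects the
  edges leaving it; it replaces the total unimodularity of the incidence matrix.\<close>

lemma incidence_cut:
  fixes F :: "'e set" and a :: 'v
  defines "K \<equiv> {u \<in> V. (a, u) \<in> conn F}"
  shows "e \<in> E \<Longrightarrow> (\<Sum>u\<in>K. incidence e u) = of_bool (tgt e \<in> K) - of_bool (src e \<in> K)"
    and "F \<subseteq> E \<Longrightarrow> f \<in> F \<Longrightarrow> (\<Sum>u\<in>K. incidence f u) = 0"
proof -
  have fin: "finite K" using finite_verts by (simp add: K_def)
  have sum: "(\<Sum>u\<in>K. incidence e u) = of_bool (tgt e \<in> K) - of_bool (src e \<in> K)" for e
    unfolding incidence_def sum_subtractf using fin by (simp add: of_bool_def)
  then show "(\<Sum>u\<in>K. incidence e u) = of_bool (tgt e \<in> K) - of_bool (src e \<in> K)" .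
  assume f: "F \<subseteq> E" "f \<in> F"
  then have fE: "f \<in> E" by blast
  note conn = adjacent_edge[OF f(2) fE]
  have "tgt f \<in> K \<longleftrightarrow> src f \<in> K"
    using src_tgt_in_verts[OF fE] rtrancl_trans[OF _ conn, of a] rtrancl_trans[OF _ conn_sym[OF conn], of a]
    unfolding K_def by simp argo
  then show "(\<Sum>u\<in>K. incidence f u) = 0" by (simp add: sum)
qed

lemma sum_cut:
  assumes "\<And>u. (\<Sum>f\<in>F. c f * incidence f u) = 0"
  shows "(\<Sum>f\<in>F. c f * (\<Sum>u\<in>K. incidence f u)) = 0"
proof -
  have "(\<Sum>f\<in>F. c f * (\<Sum>u\<in>K. incidence f u)) = (\<Sum>u\<in>K. \<Sum>f\<in>F. c f * incidence f u)"
    unfolding sum_distrib_left by (rule sum.swap)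
  then show ?thesis using assms by simp
qed

text \<open>The component of \<open>tgt e\<close> in F - {e} has e as the only edge of F leaving it.
  Summing the relation over this component isolates the coefficient of e.\<close>

lemma forest_independent:
  assumes F: "forest F" and 0: "\<And>u. (\<Sum>f\<in>F. c f * incidence f u) = 0" and e: "e \<in> F"
  shows "c e = 0"
proof -
  have FE: "F \<subseteq> E" and e_sep: "(src e, tgt e) \<notin> conn (F - {e})" using F e by (auto simp: forest_def)
  have eE: "e \<in> E" using FE e by blast
  have fin: "finite F" using FE finite_edges by (rule finite_subset)
  define K where "K = {u \<in> V. (tgt e, u) \<in> conn (F - {e})}"
  have "(\<Sum>u\<in>K. incidence f u) = 0" if "f \<in> F - {e}" for f
    unfolding K_def by (rule incidence_cut(2)[OF _ that]) (use FE in blast)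
  moreover have "(\<Sum>u\<in>K. incidence e u) = 1"
  proof -
    have "tgt e \<in> K" using src_tgt_in_verts(2)[OF eE] by (simp add: K_def)
    moreover have "src e \<notin> K" using e_sep conn_sym by (auto simp: K_def)
    ultimately show ?thesis
      using incidence_cut(1)[OF eE, of "tgt e" "F - {e}"] unfolding K_def by simp
  qed
  ultimately have "(\<Sum>f\<in>F. c f * (\<Sum>u\<in>K. incidence f u)) = c e"
    using fin e by (simp add: sum.remove[of F e])
  then show ?thesis using sum_cut[where K = K, OF 0] by simp
qed

text \<open>A path avoiding e expresses the incidence vector of e through the others; moving it
  across gives the coefficient -1.\<close>

lemma not_forest_dependent:
  assumes F: "F \<subseteq> E" "\<not> forest F"
  shows "\<exists>c. (\<exists>e\<in>F. c e \<noteq> 0) \<and> (\<forall>u. (\<Sum>f\<in>F. c f * incidence f u) = 0)"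
proof -
  obtain e where e: "e \<in> F" "(src e, tgt e) \<in> conn (F - {e})" using F by (auto simp: forest_def)
  have "F - {e} \<subseteq> E" using F(1) by blast
  from incidence_telescope[OF this e(2)]
  obtain c where c: "\<And>u. incidence e u = (\<Sum>f\<in>F - {e}. c f * incidence f u)"
    by (auto simp: incidence_def)
  have fin: "finite F" using F(1) finite_edges by (rule finite_subset)
  have "(\<Sum>f\<in>F. (if f = e then - 1 else c f) * incidence f u) = 0" for u
  proof -
    have "(\<Sum>f\<in>F. (if f = e then - 1 else c f) * incidence f u) =
        - incidence e u + (\<Sum>f\<in>F - {e}. (if f = e then - 1 else c f) * incidence f u)"
      using fin e(1) by (simp add: sum.remove[of F e])
    also have "(\<Sum>f\<in>F - {e}. (if f = e then - 1 else c f) * incidence f u) = (\<Sum>f\<in>F - {e}. c f * incidence f u)"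
      by (rule sum.cong) auto
    finally show ?thesis by (simp add: c[symmetric])
  qed
  then show ?thesis using e(1) by (intro exI[of _ "\<lambda>f. if f = e then - 1 else c f"]) auto
qed

text \<open>Linear algebra replaces the rerouting of paths: in a relation on the enlarged set, the
  cut around the component of \<open>tgt e\<close> in X kills the coefficient of e, and independence
  of X kills the others.\<close>

lemma forest_insert:
  assumes X: "forest X" and e: "e \<in> E" "(src e, tgt e) \<notin> conn X"
  shows "forest (insert e X)"
proof (rule ccontr)
  assume not_forest: "\<not> forest (insert e X)"
  have XE: "X \<subseteq> E" using X by (simp add: forest_def)
  have fin: "finite X" using XE finite_edges by (rule finite_subset)
  have eX: "e \<notin> X" using e adjacent_edge by blast
  obtain c g where g: "g \<in> insert e X" "c g \<noteq> 0"
    and c: "\<And>u. (\<Sum>f\<in>insert e X. c f * incidence f u) = 0"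
    using not_forest_dependent[OF _ not_forest] XE e(1) by blast
  define K where "K = {u \<in> V. (tgt e, u) \<in> conn X}"
  have "(\<Sum>u\<in>K. incidence f u) = 0" if "f \<in> X" for f
    unfolding K_def by (rule incidence_cut(2)[OF XE that])
  moreover have "(\<Sum>u\<in>K. incidence e u) = 1"
  proof -
    have "tgt e \<in> K" using src_tgt_in_verts(2)[OF e(1)] by (simp add: K_def)
    moreover have "src e \<notin> K" using e(2) conn_sym by (auto simp: K_def)
    ultimately show ?thesis
      using incidence_cut(1)[OF e(1), of "tgt e" X] unfolding K_def by simp
  qed
  ultimately have ce: "c e = 0"
    using sum_cut[where K = K, OF c] fin eX by simp
  then have "(\<Sum>f\<in>X. c f * incidence f u) = 0" for u using c[of u] fin eX by simp
  then have "c f = 0" if "f \<in> X" for f using forest_independent[OF X _ that] by blast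
  with g ce show False by auto
qed

text \<open>Exchange is a dimension count. If no edge of Y extends X, then X joins the ends of every
  edge of Y, whose incidence vector is thus an integral combination of those of X. More such vectors
  than X has edges are dependent, against the independence of a forest.\<close>

lemma matroid_graphic: "matroid E (graphic_indep E ends)"
proof
  show "finite E" by (rule finite_edges)
  show "X \<subseteq> E" if "graphic_indep E ends X" for X using that by (simp add: graphic_indep_def)
  show "graphic_indep E ends {}" by (simp add: graphic_indep_iff_forest forest_def)
  show "graphic_indep E ends Y" if "graphic_indep E ends X" "Y \<subseteq> X" for X Y
    using that unfolding graphic_indep_def by blast
  fix X Y assume X: "graphic_indep E ends X" and Y: "graphic_indep E ends Y" and less: "card X < card Y"
  show "\<exists>e\<in>Y - X. graphic_indep E ends (insert e X)"
  proof (rule ccontr)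
    assume no: "\<not> ?thesis"
    have fX: "forest X" and fY: "forest Y" using X Y by (simp_all add: graphic_indep_iff_forest)
    then have XE: "X \<subseteq> E" and YE: "Y \<subseteq> E" by (auto simp: forest_def)
    have fin: "finite X" "finite Y" using XE YE finite_edges finite_subset by blast+
    have "(src e, tgt e) \<in> conn X" if "e \<in> Y" for e
    proof (cases "e \<in> X")
      case True
      then show ?thesis using adjacent_edge that YE by blast
    next
      case False
      then have "\<not> forest (insert e X)" using no that by (auto simp: graphic_indep_iff_forest)
      then show ?thesis using forest_insert[OF fX] that YE by blast
    qed
    then have "\<exists>c. \<forall>u. incidence e u = (\<Sum>f\<in>X. c f * incidence f u)" if "e \<in> Y" for e
      using incidence_telescope[OF XE, of "src e" "tgt e"] that by (simp add: incidence_def)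
    then obtain A where A: "\<And>e u. e \<in> Y \<Longrightarrow> incidence e u = (\<Sum>f\<in>X. A e f * incidence f u)"
      by metis
    obtain xs where xs: "distinct xs" "set xs = X" using finite_distinct_list[OF fin(1)] by blast
    obtain ys where ys: "distinct ys" "set ys = Y" using finite_distinct_list[OF fin(2)] by blast
    define m where "m = length xs"
    have lens: "Suc m \<le> length ys" using less distinct_card[OF xs(1)] distinct_card[OF ys(1)] xs(2) ys(2) by (simp add: m_def)
    obtain c where c: "\<exists>i<Suc m. c i \<noteq> 0" "\<And>k. k < m \<Longrightarrow> (\<Sum>i<Suc m. c i * A (ys ! i) (xs ! k)) = 0"
      using int_dependent[of m "\<lambda>i k. A (ys ! i) (xs ! k)"] by blast
    \<comment> \<open>Only the first m + 1 edges of Y enter, one more than X has; \<open>d\<close>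
      moves the coefficients from positions to edges.\<close>
    define Z where "Z = (!) ys ` {..<Suc m}"
    have inj: "inj_on ((!) ys) {..<Suc m}" using ys(1) lens by (auto simp: inj_on_def nth_eq_iff_index_eq)
    define d where "d e = c (inv_into {..<Suc m} ((!) ys) e)" for e
    have d: "d (ys ! i) = c i" if "i < Suc m" for i using inj that by (simp add: d_def)
    have ZY: "Z \<subseteq> Y" using lens ys(2) by (auto simp: Z_def)
    have XA: "(\<Sum>i<Suc m. c i * A (ys ! i) f) = 0" if "f \<in> X" for f
      using c(2) that xs(2) unfolding m_def by (auto simp: in_set_conv_nth)
    have "(\<Sum>f\<in>Z. d f * incidence f u) = 0" for u
    proof -
      have "(\<Sum>f\<in>Z. d f * incidence f u) = (\<Sum>i<Suc m. c i * incidence (ys ! i) u)"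
        unfolding Z_def by (subst sum.reindex[OF inj]) (auto simp: d intro!: sum.cong)
      also have "\<dots> = (\<Sum>i<Suc m. \<Sum>f\<in>X. c i * A (ys ! i) f * incidence f u)"
      proof (rule sum.cong[OF refl])
        fix i assume "i \<in> {..<Suc m}"
        then have "ys ! i \<in> Y" using ZY by (auto simp: Z_def)
        then show "c i * incidence (ys ! i) u = (\<Sum>f\<in>X. c i * A (ys ! i) f * incidence f u)"
          using A[of "ys ! i" u] by (simp add: sum_distrib_left mult.assoc)
      qed
      also have "\<dots> = (\<Sum>f\<in>X. (\<Sum>i<Suc m. c i * A (ys ! i) f) * incidence f u)"
        unfolding sum_distrib_right by (rule sum.swap)
      also have "\<dots> = 0" using XA by (intro sum.neutral) auto
      finally show ?thesis .
    qed
    moreover have "forest Z"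
      using Y ZY unfolding graphic_indep_iff_forest[symmetric] graphic_indep_def by blast
    ultimately have "d f = 0" if "f \<in> Z" for f using forest_independent that by blast
    then have "c i = 0" if "i < Suc m" for i using d[OF that] that by (auto simp: Z_def)
    with c(1) show False by blast
  qed
qed

end

lemma sum_delta_mult:
  fixes f :: "nat \<Rightarrow> int"
  assumes "i < r"
  shows "(\<Sum>k<r. (if i = k then 1 else 0) * f k) = f i"
proof -
  have "(\<Sum>k<r. (if i = k then 1 else 0) * f k) = (\<Sum>k<r. if k = i then f k else 0)"
    by (rule sum.cong) auto
  then show ?thesis using assms by simp
qed

section \<open>Bases and rank of the dual matroid\<close>

context matroid
begin

text \<open>A dual independent set avoids some basis, so a maximal one is the full complement of it.
  Conversely, distinct complements are never nested, because bases have equal size.\<close>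

lemma bases_dual: "bases E (dual_indep E indep) = (\<lambda>S. E - S) ` bases E indep"
proof (intro equalityI subsetI)
  fix X assume X: "X \<in> bases E (dual_indep E indep)"
  then obtain B where B: "B \<in> bases E indep" "X \<subseteq> E - B" by (auto simp: bases_def dual_indep_def)
  then have "dual_indep E indep (E - B)" by (auto simp: dual_indep_def)
  then have "E - B = X" using X B(2) unfolding bases_def by blast
  with B(1) show "X \<in> (\<lambda>S. E - S) ` bases E indep" by blast
next
  fix X assume "X \<in> (\<lambda>S. E - S) ` bases E indep"
  then obtain B where B: "B \<in> bases E indep" "X = E - B" by blast
  have "Y = X" if Y: "dual_indep E indep Y" "X \<subseteq> Y" for Y
  proof -
    obtain B' where B': "B' \<in> bases E indep" "Y \<subseteq> E - B'" using Y(1) by (auto simp: dual_indep_def)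
    have "B' \<subseteq> B" using B' B Y(2) bases_subset by blast
    then have "B' = B"
      using B'(1) B(1) card_subset_eq[of B B'] bases_subset indep_finite bases_iff by auto
    then show ?thesis using B' B Y(2) by blast
  qed
  then show "X \<in> bases E (dual_indep E indep)"
    using B by (auto simp: bases_def[of E "dual_indep E indep"] dual_indep_def)
qed

lemma matroid_rank_dual: "matroid_rank E (dual_indep E indep) = card E - matroid_rank E indep"
  unfolding matroid_rank_def[of E "dual_indep E indep"]
proof (rule Max_eqI)
  have card: "card (E - B) = card E - matroid_rank E indep" if "B \<in> bases E indep" for B
    using bases_subset[OF that] finite_ground finite_subset by (subst card_Diff_subset) auto
  show "finite (card ` {X. X \<subseteq> E \<and> dual_indep E indep X})" using finite_ground by simp
  show "k \<le> card E - matroid_rank E indep" if k: "k \<in> card ` {X. X \<subseteq> E \<and> dual_indep E indep X}" for k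
  proof -
    obtain X B where XB: "k = card X" "B \<in> bases E indep" "X \<subseteq> E - B"
      using k by (auto simp: dual_indep_def)
    have "finite (E - B)" using finite_ground by simp
    from card_mono[OF this XB(3)] show ?thesis using card[OF XB(2)] XB(1) by simp
  qed
  obtain B where B: "B \<in> bases E indep" using bases_nonempty by blast
  then have "E - B \<in> {X. X \<subseteq> E \<and> dual_indep E indep X}" by (auto simp: dual_indep_def)
  then show "card E - matroid_rank E indep \<in> card ` {X. X \<subseteq> E \<and> dual_indep E indep X}"
    using card[OF B] by (metis imageI)
qed

lemma basis_poly_dual:
  "basis_poly E (dual_indep E indep) x = (\<Sum>S\<in>bases E indep. \<Prod>e\<in>E - S. x e)"
proof -
  have "inj_on (\<lambda>S. E - S) (bases E indep)"
    by (rule inj_onI) (use bases_subset in blast)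
  then show ?thesis unfolding basis_poly_def bases_dual by (simp add: sum.reindex)
qed

end

section \<open>Integral coordinates with respect to a spanning forest\<close>

context multigraph
begin

abbreviation graphic_bases :: "'e set set" where
  "graphic_bases \<equiv> bases E (graphic_indep E ends)"
abbreviation graphic_rank :: nat where
  "graphic_rank \<equiv> matroid_rank E (graphic_indep E ends)"

lemma graphic_bases_iff: "S \<in> graphic_bases \<longleftrightarrow> forest S \<and> card S = graphic_rank"
  using matroid.bases_iff[OF matroid_graphic] by (simp add: graphic_indep_iff_forest)

text \<open>Otherwise \<open>forest_insert\<close> would enlarge the base, against its
  maximality.\<close>

lemma graphic_base_conn:
  assumes S: "S \<in> graphic_bases" and e: "e \<in> E"
  shows "(src e, tgt e) \<in> conn S"
proof (cases "e \<in> S")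
  case True
  then show ?thesis using adjacent_edge e by blast
next
  case False
  have max: "X = S" if "X \<subseteq> E" "graphic_indep E ends X" "S \<subseteq> X" for X
    using S that by (auto simp: bases_def)
  have "\<not> forest (insert e S)"
  proof
    assume f: "forest (insert e S)"
    then have "insert e S = S"
      by (intro max) (auto simp: graphic_indep_iff_forest forest_def)
    with False show False by blast
  qed
  then show ?thesis using forest_insert[of S e] S e by (auto simp: graphic_bases_iff)
qed

text \<open>Telescoping along paths keeps the coordinates integral, which is what later confines the
  minors.\<close>

lemma graphic_coordinates:
  assumes b: "distinct b" "set b \<in> graphic_bases"
  shows "\<exists>A. \<forall>e\<in>E. \<forall>u. incidence e u = (\<Sum>j<length b. A e j * incidence (b ! j) u)"
proof -
  have bE: "set b \<subseteq> E" using b(2) by (auto simp: bases_def)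
  have "\<exists>a. \<forall>u. incidence e u = (\<Sum>j<length b. a j * incidence (b ! j) u)" if e: "e \<in> E" for e
  proof -
    obtain c where c: "\<And>u. incidence e u = (\<Sum>f\<in>set b. c f * incidence f u)"
      using incidence_telescope[OF bE graphic_base_conn[OF b(2) e]] by (auto simp: incidence_def)
    have "(\<Sum>f\<in>set b. c f * incidence f u) = (\<Sum>j<length b. c (b ! j) * incidence (b ! j) u)" for u
      using sum.reindex_bij_betw[OF bij_betw_nth[OF b(1) refl refl], of "\<lambda>f. c f * incidence f u"] by simp
    then show ?thesis using c by (intro exI[of _ "\<lambda>j. c (b ! j)"]) simp
  qed
  then have "\<forall>e\<in>E. \<exists>a. \<forall>u. incidence e u = (\<Sum>j<length b. a j * incidence (b ! j) u)" by blast
  from bchoice[OF this] show ?thesis .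
qed

lemma forest_list_independent:
  assumes b: "distinct b" "forest (set b)" and 0: "\<And>u. (\<Sum>j<length b. c j * incidence (b ! j) u) = 0"
    and j: "j < length b"
  shows "c j = 0"
proof -
  define d where "d f = c (THE j. j < length b \<and> b ! j = f)" for f
  have d: "d (b ! j) = c j" if "j < length b" for j
  proof -
    have "(THE k. k < length b \<and> b ! k = b ! j) = j"
      using that b(1) by (intro the_equality) (auto simp: nth_eq_iff_index_eq)
    then show ?thesis by (simp add: d_def)
  qed
  have "(\<Sum>f\<in>set b. d f * incidence f u) = 0" for u
    using sum.reindex_bij_betw[OF bij_betw_nth[OF b(1) refl refl], of "\<lambda>f. d f * incidence f u"] 0[of u]
    by (simp add: d)
  from forest_independent[OF b(2) this, of "b ! j"] show ?thesis using d[OF j] j by simp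
qed

text \<open>Change of coordinates as a matrix product, from \<open>es\<close> to \<open>b\<close>.
  It yields the inverse matrix and also carries linear relations over.\<close>

lemma coordinates_mult:
  assumes "\<And>u. (\<Sum>i<n. c i * incidence (es ! i) u) = s u" "\<And>i. i < n \<Longrightarrow> es ! i \<in> E"
    and A: "\<And>e u. e \<in> E \<Longrightarrow> incidence e u = (\<Sum>j<m. A e j * incidence (b ! j) u)"
  shows "(\<Sum>j<m. (\<Sum>i<n. c i * A (es ! i) j) * incidence (b ! j) u) = s u"
proof -
  have "(\<Sum>j<m. (\<Sum>i<n. c i * A (es ! i) j) * incidence (b ! j) u) =
      (\<Sum>i<n. \<Sum>j<m. c i * A (es ! i) j * incidence (b ! j) u)"
    unfolding sum_distrib_right by (rule sum.swap)
  also have "\<dots> = (\<Sum>i<n. c i * incidence (es ! i) u)"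
  proof (rule sum.cong[OF refl])
    fix i assume "i \<in> {..<n}"
    then have "es ! i \<in> E" using assms(2) by simp
    from A[OF this, of u] show "(\<Sum>j<m. c i * A (es ! i) j * incidence (b ! j) u) = c i * incidence (es ! i) u"
      by (simp add: sum_distrib_left mult.assoc)
  qed
  finally show ?thesis using assms(1) by simp
qed

lemma graphic_minors:
  assumes b: "distinct b" "set b \<in> graphic_bases" "length b = r"
    and A: "\<And>e u. e \<in> E \<Longrightarrow> incidence e u = (\<Sum>j<r. A e j * incidence (b ! j) u)"
    and es: "distinct es" "set es \<subseteq> E" "length es = r"
  shows "\<bar>Determinant.det (mat r r (\<lambda>(i, j). A (es ! i) j))\<bar> = (if set es \<in> graphic_bases then 1 else 0)"
proof -
  let ?M = "mat r r (\<lambda>(i, j). A (es ! i) j)"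
  have M: "?M \<in> carrier_mat r r" by simp
  have fb: "forest (set b)" and r: "r = graphic_rank"
    using b distinct_card[OF b(1)] by (simp_all add: graphic_bases_iff)
  have esE: "es ! i \<in> E" if "i < r" for i using es that nth_mem[of i es] by auto
  have bE: "b ! i \<in> E" if "i < r" for i using b that nth_mem[of i b] by (auto simp: bases_def)
  show ?thesis
  proof (cases "set es \<in> graphic_bases")
    case True
    obtain C where C: "\<And>e u. e \<in> E \<Longrightarrow> incidence e u = (\<Sum>j<r. C e j * incidence (es ! j) u)"
      using graphic_coordinates[OF es(1) True] es(3) by blast
    \<comment> \<open>Writing an edge of \<open>b\<close> through \<open>es\<close> and then again
      through \<open>b\<close> must return a unit vector, since coordinates with respect to a forest
      are unique.\<close>
    have CA: "(\<Sum>j<r. C (b ! i) j * A (es ! j) k) = (if i = k then 1 else 0)" if ik: "i < r" "k < r" for i k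
    proof -
      have "(\<Sum>k<r. (\<Sum>j<r. C (b ! i) j * A (es ! j) k) * incidence (b ! k) u) = incidence (b ! i) u" for u
        by (rule coordinates_mult[OF C[OF bE[OF ik(1)], symmetric] esE A])
      moreover have "(\<Sum>k<r. (if i = k then 1 else 0) * incidence (b ! k) u) = incidence (b ! i) u" for u
        by (rule sum_delta_mult[OF ik(1)])
      ultimately have "(\<Sum>k<length b. ((\<Sum>j<r. C (b ! i) j * A (es ! j) k) - (if i = k then 1 else 0)) *
          incidence (b ! k) u) = 0" for u
        by (simp only: b(3) left_diff_distrib sum_subtractf)
      from forest_list_independent[OF b(1) fb this, of k] show ?thesis using ik(2) b(3) by simp
    qed
    let ?C = "mat r r (\<lambda>(i, j). C (b ! i) j)"
    have "?C * ?M = 1\<^sub>m r"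
      by (rule eq_matI) (auto simp: scalar_prod_def lessThan_atLeast0[symmetric] CA)
    then have "Determinant.det ?C * Determinant.det ?M = 1"
      using det_mult[of ?C r ?M] by simp
    then have "\<bar>Determinant.det ?M\<bar> = 1"
      by (metis abs_zmult_eq_1 mult.commute abs_one)
    then show ?thesis using True by simp
  next
    case False
    then have "\<not> forest (set es)" using es r distinct_card[OF es(1)] by (simp add: graphic_bases_iff)
    \<comment> \<open>The relation among the edges of \<open>es\<close> passes to their coordinate
      rows and gives a nonzero kernel vector of the transposed matrix.\<close>
    from not_forest_dependent[OF es(2) this] obtain c e where e: "e \<in> set es" "c e \<noteq> 0"
      and c: "\<And>u. (\<Sum>f\<in>set es. c f * incidence f u) = 0" by blast
    have "(\<Sum>i<r. c (es ! i) * incidence (es ! i) u) = 0" for u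
      using sum.reindex_bij_betw[OF bij_betw_nth[OF es(1) refl refl], of "\<lambda>f. c f * incidence f u"] c[of u] es(3)
      by simp
    from coordinates_mult[OF this esE A]
    have "(\<Sum>j<length b. (\<Sum>i<r. c (es ! i) * A (es ! i) j) * incidence (b ! j) u) = 0" for u
      by (simp add: b(3))
    from forest_list_independent[OF b(1) fb this]
    have cA: "(\<Sum>i<r. c (es ! i) * A (es ! i) j) = 0" if "j < r" for j using that b(3) by simp
    define w where "w = vec r (\<lambda>i. c (es ! i))"
    have "transpose_mat ?M *\<^sub>v w = 0\<^sub>v r"
      by (rule eq_vecI) (auto simp: w_def scalar_prod_def lessThan_atLeast0[symmetric] mult.commute cA)
    moreover have "w \<noteq> 0\<^sub>v r"
    proof
      assume "w = 0\<^sub>v r"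
      moreover obtain i where "i < r" "es ! i = e" using e(1) es(3) by (auto simp: in_set_conv_nth)
      ultimately show False using e(2) by (auto simp: w_def vec_eq_iff)
    qed
    moreover have "w \<in> carrier_vec r" "transpose_mat ?M \<in> carrier_mat r r" by (simp_all add: w_def)
    ultimately have "Determinant.det (transpose_mat ?M) = 0"
      using det_0_iff_vec_prod_zero by blast
    then show ?thesis using False det_transpose[OF M] by simp
  qed
qed

text \<open>The coordinates have the shape [I | A] with respect to \<open>b\<close>, as the passage
  to the dual requires.\<close>

lemma unimodular_coordinates:
  obtains b and v :: "'e \<Rightarrow> nat \<Rightarrow> complex"
  where "distinct b" "set b \<subseteq> E" "length b = graphic_rank" "\<And>e i. v e i \<in> \<real>"
    and "\<And>i j. i < graphic_rank \<Longrightarrow> j < graphic_rank \<Longrightarrow> v (b ! i) j = (if i = j then 1 else 0)"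
    and "\<And>es. distinct es \<Longrightarrow> set es \<subseteq> E \<Longrightarrow> length es = graphic_rank \<Longrightarrow>
      cmod (Determinant.det (mat graphic_rank graphic_rank (\<lambda>(i, j). v (es ! i) j))) ^ 2 =
      (if set es \<in> graphic_bases then 1 else 0)"
proof -
  obtain B where B: "B \<in> graphic_bases" using matroid.bases_nonempty[OF matroid_graphic] by blast
  then have "finite B" using finite_edges finite_subset by (auto simp: bases_def)
  then obtain b where b: "distinct b" "set b = B" using finite_distinct_list by blast
  define r where "r = graphic_rank"
  have len: "length b = r" using distinct_card[OF b(1)] b(2) B by (simp add: graphic_bases_iff r_def)
  have bB: "set b \<in> graphic_bases" using B b by simp
  obtain A where A: "\<And>e u. e \<in> E \<Longrightarrow> incidence e u = (\<Sum>j<r. A e j * incidence (b ! j) u)"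
    using graphic_coordinates[OF b(1) bB] len by blast
  have bE: "set b \<subseteq> E" using bB by (auto simp: bases_def)
  have unit: "A (b ! i) j = (if i = j then 1 else 0)" if ij: "i < r" "j < r" for i j
  proof -
    have "b ! i \<in> E" using bE ij len nth_mem[of i b] by auto
    have "(\<Sum>j<length b. (A (b ! i) j - (if i = j then 1 else 0)) * incidence (b ! j) u) = 0" for u
      using A[OF \<open>b ! i \<in> E\<close>, of u] sum_delta_mult[OF ij(1), of "\<lambda>k. incidence (b ! k) u"]
      by (simp only: len left_diff_distrib sum_subtractf)
    from forest_list_independent[OF b(1) _ this, of j] show ?thesis
      using bB ij(2) len by (simp add: graphic_bases_iff)
  qed
  show thesis
  proof (rule that[of b "\<lambda>e i. of_int (A e i)"])
    show "cmod (Determinant.det (mat graphic_rank graphic_rank (\<lambda>(i, j). complex_of_int (A (es ! i) j)))) ^ 2 =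
        (if set es \<in> graphic_bases then 1 else 0)"
      if es: "distinct es" "set es \<subseteq> E" "length es = graphic_rank" for es
    proof -
      let ?M = "mat r r (\<lambda>(i, j). A (es ! i) j)"
      have "mat r r (\<lambda>(i, j). complex_of_int (A (es ! i) j)) = map_mat of_int ?M"
        by (intro eq_matI) auto
      then have "Determinant.det (mat r r (\<lambda>(i, j). complex_of_int (A (es ! i) j))) = of_int (Determinant.det ?M)"
        by (simp add: of_int_hom.hom_det)
      moreover have "\<bar>Determinant.det ?M\<bar> = (if set es \<in> graphic_bases then 1 else 0)"
        by (rule graphic_minors[OF b(1) bB len A es(1,2)]) (use es(3) r_def in simp_all)
      moreover have "cmod (complex_of_int (Determinant.det ?M)) ^ 2 = real_of_int (\<bar>Determinant.det ?M\<bar> ^ 2)"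
        by (simp add: norm_of_int)
      ultimately show ?thesis unfolding r_def[symmetric] by simp
    qed
  qed (use b bE len unit in \<open>auto simp: r_def\<close>)
qed

theorem graphic_completely_monotone:
  assumes \<beta>: "\<beta> \<in> real_exponents graphic_rank"
  shows "completely_monotone E (\<lambda>x. basis_poly E (graphic_indep E ends) x powr - \<beta>)"
proof -
  interpret M: matroid E "graphic_indep E ends" by (rule matroid_graphic)
  interpret gaussian_field \<real> lborel "\<lambda>t::real. complex_of_real (sqrt pi * t)" "1 / 2"
    by (rule gaussian_field_real)
  obtain b and v :: "'e \<Rightarrow> nat \<Rightarrow> complex" where v: "\<And>e i. v e i \<in> \<real>"
    "\<And>es. distinct es \<Longrightarrow> set es \<subseteq> E \<Longrightarrow> length es = graphic_rank \<Longrightarrow>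
      cmod (Determinant.det (mat graphic_rank graphic_rank (\<lambda>(i, j). v (es ! i) j))) ^ 2 =
      (if set es \<in> graphic_bases then 1 else 0)"
    by (rule unimodular_coordinates) blast
  show ?thesis
    unfolding basis_poly_def
  proof (rule completely_monotone_basis_sum[where r = graphic_rank and v = v])
    show "(\<exists>m::nat. \<beta> = real m * (1 / 2)) \<or> \<beta> \<ge> (real graphic_rank - 1) * (1 / 2)"
      using \<beta> by (auto simp: real_exponents_def)
    show "cmod (Determinant.det (mat graphic_rank graphic_rank (\<lambda>(i, j). v (es ! i) j))) ^ 2 =
        (if set es \<in> graphic_bases then 1 else 0)"
      if "distinct es" "set es \<subseteq> E" "length es = graphic_rank" for es
      by (rule v(2)[OF that])
  qed (use finite_edges M.bases_subset M.bases_nonempty v(1) in auto)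
qed

text \<open>The coordinates of the graphic matroid are kept; duality enters through the Gram
  determinant, whose order card E - \<open>graphic_rank\<close> is the rank of the dual.\<close>

theorem cographic_completely_monotone:
  assumes \<beta>: "\<beta> \<in> real_exponents (matroid_rank E (cographic_indep E ends))"
  shows "completely_monotone E (\<lambda>x. basis_poly E (cographic_indep E ends) x powr - \<beta>)"
proof -
  interpret M: matroid E "graphic_indep E ends" by (rule matroid_graphic)
  interpret gaussian_field \<real> lborel "\<lambda>t::real. complex_of_real (sqrt pi * t)" "1 / 2"
    by (rule gaussian_field_real)
  obtain b and v :: "'e \<Rightarrow> nat \<Rightarrow> complex" where b: "distinct b" "set b \<subseteq> E" "length b = graphic_rank"
    and v: "\<And>e i. v e i \<in> \<real>"
      "\<And>i j. i < graphic_rank \<Longrightarrow> j < graphic_rank \<Longrightarrow> v (b ! i) j = (if i = j then 1 else 0)"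
      "\<And>es. distinct es \<Longrightarrow> set es \<subseteq> E \<Longrightarrow> length es = graphic_rank \<Longrightarrow>
        cmod (Determinant.det (mat graphic_rank graphic_rank (\<lambda>(i, j). v (es ! i) j))) ^ 2 =
        (if set es \<in> graphic_bases then 1 else 0)"
    by (rule unimodular_coordinates) blast
  show ?thesis
    unfolding M.basis_poly_dual
  proof (rule completely_monotone_cobasis_sum[where r = graphic_rank and v = v and b = b])
    show "(\<exists>m::nat. \<beta> = real m * (1 / 2)) \<or> \<beta> \<ge> (real (card E - graphic_rank) - 1) * (1 / 2)"
      using \<beta> by (auto simp: real_exponents_def M.matroid_rank_dual)
    show "cmod (Determinant.det (mat graphic_rank graphic_rank (\<lambda>(i, j). v (es ! i) j))) ^ 2 =
        (if set es \<in> graphic_bases then 1 else 0)"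
      if "distinct es" "set es \<subseteq> E" "length es = graphic_rank" for es
      by (rule v(3)[OF that])
  qed (use finite_edges M.bases_subset b v(1,2) in auto)
qed

text \<open>A spanning tree joins the ends of every further edge, so adding one destroys acyclicity,
  and the tree is a maximal forest. Conversely a base joins the ends of every edge, so it inherits
  the connectedness of the whole graph.\<close>

lemma spanning_trees_eq_bases:
  assumes "connected_by V ends E"
  shows "spanning_trees V E ends = graphic_bases"
proof (intro equalityI subsetI)
  fix T assume "T \<in> spanning_trees V E ends"
  then have T: "T \<subseteq> E" "connected_by V ends T" "graphic_indep E ends T"
    by (auto simp: spanning_trees_def graphic_indep_def)
  have "X = T" if X: "X \<subseteq> E" "graphic_indep E ends X" "T \<subseteq> X" for X
  proof (rule ccontr)
    assume "X \<noteq> T"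
    then obtain e where e: "e \<in> X" "e \<notin> T" using X(3) by blast
    then have "(src e, tgt e) \<in> conn T"
      using T(2) X(1) src_tgt_in_verts[of e] by (auto simp: connected_by_def)
    then have "(src e, tgt e) \<in> conn (X - {e})" by (rule conn_mono[rotated]) (use X(3) e in blast)
    then show False using X(2) e(1) by (auto simp: graphic_indep_iff_forest forest_def)
  qed
  with T show "T \<in> graphic_bases" by (auto simp: bases_def)
next
  fix T assume T: "T \<in> graphic_bases"
  have "adjacent_via ends E \<subseteq> conn T"
  proof
    fix p assume "p \<in> adjacent_via ends E"
    then obtain u w e where e: "p = (u, w)" "e \<in> E" "ends e = {u, w}" by (auto simp: adjacent_via_def)
    then have "{src e, tgt e} = {u, w}" using ends_eq by simp
    then have "(u, w) = (src e, tgt e) \<or> (u, w) = (tgt e, src e)" by (auto simp: doubleton_eq_iff)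
    then show "p \<in> conn T" using graphic_base_conn[OF T e(2)] conn_sym e(1) by auto
  qed
  then have "conn E \<subseteq> conn T" by (rule rtrancl_subset_rtrancl)
  with assms have "connected_by V ends T" unfolding connected_by_def by blast
  with T show "T \<in> spanning_trees V E ends"
    by (auto simp: spanning_trees_def bases_def graphic_indep_def)
qed

end

theorem corollary1p8:
  fixes E :: "'e set" and indep :: "'e set \<Rightarrow> bool" and r :: nat
  assumes "matroid E indep" and "matroid_rank E indep = r"
  shows
    "(real_unimodular E indep \<longrightarrow>
        (\<forall>\<beta>\<in>real_exponents r.
           completely_monotone E (\<lambda>x. basis_poly E indep x powr (- \<beta>)))) \<and>
     (\<forall>(V :: 'v set) ends.
        multigraph V E ends \<and>
        (indep = graphic_indep E ends \<or> indep = cographic_indep E ends) \<longrightarrow>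
        (\<forall>\<beta>\<in>real_exponents r.
           completely_monotone E (\<lambda>x. basis_poly E indep x powr (- \<beta>)))) \<and>
     (\<forall>(V :: 'v set) ends.
        multigraph V E ends \<and> connected_by V ends E \<longrightarrow>
        (\<forall>\<beta>\<in>real_exponents (matroid_rank E (graphic_indep E ends)).
           completely_monotone E (\<lambda>x. spanning_tree_poly V E ends x powr (- \<beta>))) \<and>
        (\<forall>\<beta>\<in>real_exponents (matroid_rank E (cographic_indep E ends)).
           completely_monotone E (\<lambda>x. complementary_spanning_tree_poly V E ends x powr (- \<beta>)))) \<and>
     (complex_unimodular E indep \<longrightarrow>
        (\<forall>\<beta>\<in>complex_exponents r.
           completely_monotone E (\<lambda>x. basis_poly E indep x powr (- \<beta>))))"
proof (intro conjI impI allI ballI)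
  fix \<beta> assume "real_unimodular E indep" "\<beta> \<in> real_exponents r"
  then show "completely_monotone E (\<lambda>x. basis_poly E indep x powr - \<beta>)"
    using matroid.real_unimodular_completely_monotone[OF assms(1)] assms(2) by simp
next
  fix \<beta> assume "complex_unimodular E indep" "\<beta> \<in> complex_exponents r"
  then show "completely_monotone E (\<lambda>x. basis_poly E indep x powr - \<beta>)"
    using matroid.complex_unimodular_completely_monotone[OF assms(1)] assms(2) by simp
next
  fix V :: "'v set" and ends \<beta>
  assume "multigraph V E ends \<and> (indep = graphic_indep E ends \<or> indep = cographic_indep E ends)"
    and \<beta>: "\<beta> \<in> real_exponents r"
  then have G: "multigraph V E ends" and "indep = graphic_indep E ends \<or> indep = cographic_indep E ends"
    by auto
  then show "completely_monotone E (\<lambda>x. basis_poly E indep x powr - \<beta>)"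
    using multigraph.graphic_completely_monotone[OF G, of \<beta>]
      multigraph.cographic_completely_monotone[OF G, of \<beta>] \<beta> assms(2) by auto
next
  fix V :: "'v set" and ends \<beta>
  assume "multigraph V E ends \<and> connected_by V ends E"
    and \<beta>: "\<beta> \<in> real_exponents (matroid_rank E (graphic_indep E ends))"
  then have G: "multigraph V E ends" and conn: "connected_by V ends E" by auto
  have "spanning_tree_poly V E ends = basis_poly E (graphic_indep E ends)"
    using multigraph.spanning_trees_eq_bases[OF G conn]
    by (simp add: fun_eq_iff spanning_tree_poly_def basis_poly_def)
  then show "completely_monotone E (\<lambda>x. spanning_tree_poly V E ends x powr - \<beta>)"
    using multigraph.graphic_completely_monotone[OF G \<beta>] by simp
next
  fix V :: "'v set" and ends \<beta>
  assume "multigraph V E ends \<and> connected_by V ends E"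
    and \<beta>: "\<beta> \<in> real_exponents (matroid_rank E (cographic_indep E ends))"
  then have G: "multigraph V E ends" and conn: "connected_by V ends E" by auto
  have "complementary_spanning_tree_poly V E ends = basis_poly E (cographic_indep E ends)"
    using multigraph.spanning_trees_eq_bases[OF G conn]
      matroid.basis_poly_dual[OF multigraph.matroid_graphic[OF G]]
    by (simp add: fun_eq_iff complementary_spanning_tree_poly_def)
  then show "completely_monotone E (\<lambda>x. complementary_spanning_tree_poly V E ends x powr - \<beta>)"
    using multigraph.cographic_completely_monotone[OF G \<beta>] by simp
qed

end
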